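(* Let $n\ge 1$ and let $A=(a_{ij})\in\hat{\mathbb H}^{n\times n}$ be a dual quaternion Hermitian matrix. Then $$\mathrm{Mdet}(A)=\mathrm{Cdet}(A),$$ where $\mathrm{Mdet}$ is the Moore determinant and $\mathrm{Cdet}$ is the Chen determinant. Furthermore, $$\mathrm{Mdet}(A)=\prod_{i=1}^n\lambda_i,$$ where $\lambda_1,\dots,\lambda_n$ are the eigenvalues of $A$.
   Context: $\mathbb H$ denotes the real quaternions with conjugation $q\mapsto q^*$. A dual quaternion is $q=q_s+q_d\epsilon$ with $q_s,q_d\in\mathbb H$, where $\epsilon\neq 0$, $\epsilon^2=0$, and $\epsilon$ commutes with all quaternions; the set of dual quaternions is $\hat{\mathbb H}$, and $q^*=q_s^*+q_d^*\epsilon$. If $q_s,q_d\in\mathbb R$, $q$ is called a dual number; the set of dual numbers is $\hat{\mathbb R}$. For $A=(a_{ij})\in\hat{\mathbb H}^{n\times n}$, $A^*=(a_{ji}^* )$; $A$ is Hermitian if $A^*=A$, and unitary if $A^*A=I_n$. Eigenvalues: $\lambda\in\hat{\mathbb H}$ is a right eigenvalue of $A$ if $A\mathbf x=\mathbf x\lambda$ for some vector $\mathbf x=\mathbf x_s+\mathbf x_d\epsilon\in\hat{\mathbb H}^n$ with $\mathbf x_s\ne 0$. It is known that an $n\times n$ dual quaternion Hermitian matrix $A$ has exactly $n$ right eigenvalues (counted with multiplicity), all of which are dual numbers and also left eigenvalues; they are simply called the eigenvalues $\lambda_1,\dots,\lambda_n$ of $A$, and there is a unitary $U\in\hat{\mathbb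 H}^{n\times n}$ with $UAU^*=\mathrm{diag}(\lambda_1,\dots,\lambda_n)$. Determinants: write a permutation $\sigma$ of $\{1,\dots,n\}$ as an ordered product of disjoint cycles (fixed points included) $$\sigma=(n_{11}\cdots n_{1l_1})(n_{21}\cdots n_{2l_2})\cdots(n_{r1}\cdots n_{rl_r}),$$ where $(i_1\cdots i_k)$ means $i_1\mapsto i_2\mapsto\cdots\mapsto i_k\mapsto i_1$, and for this written form set $$a_\sigma=(a_{n_{11}n_{12}}a_{n_{12}n_{13}}\cdots a_{n_{1l_1}n_{11}})(a_{n_{21}n_{22}}\cdots a_{n_{2l_2}n_{21}})\cdots(a_{n_{r1}n_{r2}}\cdots a_{n_{rl_r}n_{r1}})$$ (product in the indicated order). The Moore determinant of $A$ is $\mathrm{Mdet}(A)=\sum_\sigma s(\sigma)a_\sigma$, summed over all permutations $\sigma$, each written (uniquely) so that $n_{i1}<n_{ij}$ for all $j>1$ and $i=1,\dots,r$, and $n_{11}>n_{21}>\cdots>n_{r1}$; here $s(\sigma)$ is the sign of $\sigma$. The Chen determinant of $A$ is $\mathrm{Cdet}(A)=\sum_\sigma(-1)^{n-r}a_\sigma$, summed over all permutations $\sigma$, each written (uniquely) so that $n_{i1}>n_{ij}$ for all $j>1$ and $i=1,\dots,r$, and $n=n_{11}>n_{21}>\cdots>n_{r1}$; here $r$ is the number of cycles of $\sigma$. *)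

theory Defs
  imports
    "Jordan_Normal_Form.Matrix"
    "HOL-Combinatorics.Combinatorics"
    Complex_Main
begin

section \<open>Quaternions\<close>

codatatype quat = Quat (Re_q: real) (Im_i: real) (Im_j: real) (Im_k: real)

lemma quat_eqI [intro?]:
  "\<lbrakk>Re_q p = Re_q q; Im_i p = Im_i q; Im_j p = Im_j q; Im_k p = Im_k q\<rbrakk> \<Longrightarrow> p = q"
  by (rule quat.expand) simp

lemma quat_eq_iff:
  "p = q \<longleftrightarrow> Re_q p = Re_q q \<and> Im_i p = Im_i q \<and> Im_j p = Im_j q \<and> Im_k p = Im_k q"
  by (auto intro: quat_eqI)

instantiation quat :: ring_1
begin

primcorec zero_quat where
  "Re_q 0 = 0" | "Im_i 0 = 0" | "Im_j 0 = 0" | "Im_k 0 = 0"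

primcorec one_quat where
  "Re_q 1 = 1" | "Im_i 1 = 0" | "Im_j 1 = 0" | "Im_k 1 = 0"

primcorec plus_quat where
  "Re_q (p + q) = Re_q p + Re_q q"
| "Im_i (p + q) = Im_i p + Im_i q"
| "Im_j (p + q) = Im_j p + Im_j q"
| "Im_k (p + q) = Im_k p + Im_k q"

primcorec uminus_quat where
  "Re_q (- q) = - Re_q q"
| "Im_i (- q) = - Im_i q"
| "Im_j (- q) = - Im_j q"
| "Im_k (- q) = - Im_k q"

primcorec minus_quat where
  "Re_q (p - q) = Re_q p - Re_q q"
| "Im_i (p - q) = Im_i p - Im_i q"
| "Im_j (p - q) = Im_j p - Im_j q"
| "Im_k (p - q) = Im_k p - Im_k q"

primcorec times_quat where
  "Re_q (p * q) = Re_q p * Re_q q - Im_i p * Im_i q - Im_j p * Im_j q - Im_k p * Im_k q"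
| "Im_i (p * q) = Re_q p * Im_i q + Im_i p * Re_q q + Im_j p * Im_k q - Im_k p * Im_j q"
| "Im_j (p * q) = Re_q p * Im_j q - Im_i p * Im_k q + Im_j p * Re_q q + Im_k p * Im_i q"
| "Im_k (p * q) = Re_q p * Im_k q + Im_i p * Im_j q - Im_j p * Im_i q + Im_k p * Re_q q"

instance
  by standard (simp_all add: quat_eq_iff algebra_simps)

end

primcorec quat_cnj :: "quat \<Rightarrow> quat" where
  "Re_q (quat_cnj q) = Re_q q"
| "Im_i (quat_cnj q) = - Im_i q"
| "Im_j (quat_cnj q) = - Im_j q"
| "Im_k (quat_cnj q) = - Im_k q"


section \<open>Dual quaternions\<close>

text \<open>\<open>Dual a b\<close> stands for \<open>a + b \<epsilon>\<close>, where \<open>\<epsilon>\<close> is central and squares to zero.\<close>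

codatatype 'a dual = Dual (std: 'a) (inft: 'a)

lemma dual_eqI [intro?]: "\<lbrakk>std p = std q; inft p = inft q\<rbrakk> \<Longrightarrow> p = q"
  by (rule dual.expand) simp

lemma dual_eq_iff: "p = q \<longleftrightarrow> std p = std q \<and> inft p = inft q"
  by (auto intro: dual_eqI)

instantiation dual :: (ring_1) ring_1
begin

primcorec zero_dual where
  "std 0 = 0" | "inft 0 = 0"

primcorec one_dual where
  "std 1 = 1" | "inft 1 = 0"

primcorec plus_dual where
  "std (p + q) = std p + std q"
| "inft (p + q) = inft p + inft q"

primcorec uminus_dual where
  "std (- q) = - std q"
| "inft (- q) = - inft q"

primcorec minus_dual where
  "std (p - q) = std p - std q"
| "inft (p - q) = inft p - inft q"

primcorec times_dual where
  "std (p * q) = std p * std q"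
| "inft (p * q) = std p * inft q + inft p * std q"

instance
  by standard (simp_all add: dual_eq_iff algebra_simps)

end

type_synonym dual_quat = "quat dual"

definition dq_cnj :: "dual_quat \<Rightarrow> dual_quat" where
  "dq_cnj q = Dual (quat_cnj (std q)) (quat_cnj (inft q))"


section \<open>Hermitian matrices and right eigenvalues\<close>

definition dq_adjoint :: "dual_quat mat \<Rightarrow> dual_quat mat" where
  "dq_adjoint A = mat (dim_col A) (dim_row A) (\<lambda>(i, j). dq_cnj (A $$ (j, i)))"

definition dq_hermitian :: "dual_quat mat \<Rightarrow> bool" where
  "dq_hermitian A \<longleftrightarrow> dq_adjoint A = A"

definition right_eigenvector :: "dual_quat mat \<Rightarrow> dual_quat vec \<Rightarrow> dual_quat \<Rightarrow> bool" where
  "right_eigenvector A x \<mu> \<longleftrightarrow>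
     x \<in> carrier_vec (dim_row A) \<and> map_vec std x \<noteq> 0\<^sub>v (dim_row A) \<and>
     A *\<^sub>v x = map_vec (\<lambda>a. a * \<mu>) x"

definition right_eigenvalue :: "dual_quat mat \<Rightarrow> dual_quat \<Rightarrow> bool" where
  "right_eigenvalue A \<mu> \<longleftrightarrow> (\<exists>x. right_eigenvector A x \<mu>)"

definition right_independent :: "nat \<Rightarrow> quat vec list \<Rightarrow> bool" where
  "right_independent n vs \<longleftrightarrow>
     (\<forall>c. (\<forall>i<n. (\<Sum>j<length vs. (vs ! j) $ i * c j) = 0) \<longrightarrow> (\<forall>j<length vs. c j = 0))"

text \<open>
  The multiplicity of an eigenvalue is the largest number of eigenvectors whose standard parts
  are right linearly independent over the quaternions. For a Hermitian matrix this is
  the number of occurrences of the eigenvalue in a unitary diagonalization: in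
  \<open>diag(\<lambda>\<^sub>1, \<dots>, \<lambda>\<^sub>n)\<close>, an eigenvector for \<open>\<mu>\<close> has vanishing standard part in every coordinate
  \<open>i\<close> with \<open>\<lambda>\<^sub>i \<noteq> \<mu>\<close>, even if \<open>\<lambda>\<^sub>i\<close> and \<open>\<mu>\<close> only differ by an infinitesimal.
\<close>

definition eigenvalue_mult :: "dual_quat mat \<Rightarrow> dual_quat \<Rightarrow> nat" where
  "eigenvalue_mult A \<mu> =
     Max {length xs | xs. (\<forall>x\<in>set xs. right_eigenvector A x \<mu>) \<and>
                          right_independent (dim_row A) (map (map_vec std) xs)}"

text \<open>\<open>ls\<close> lists the \<open>n\<close> right eigenvalues of an \<open>n \<times> n\<close> matrix, with multiplicity.\<close>

definition eigenvalue_list :: "dual_quat mat \<Rightarrow> dual_quat list \<Rightarrow> bool" where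
  "eigenvalue_list A ls \<longleftrightarrow>
     length ls = dim_row A \<and> set ls = {\<mu>. right_eigenvalue A \<mu>} \<and>
     (\<forall>\<mu>\<in>set ls. count_list ls \<mu> = eigenvalue_mult A \<mu>)"


section \<open>The Moore and Chen determinants\<close>

text \<open>
  Indices are \<open>0, \<dots>, n - 1\<close>. A permutation written as an ordered product of disjoint cycles,
  fixed points included, is represented by the list of its cycles.
\<close>

definition cycle_notation :: "nat \<Rightarrow> (nat \<Rightarrow> nat) \<Rightarrow> nat list list \<Rightarrow> bool" where
  "cycle_notation n \<sigma> cs \<longleftrightarrow>
     [] \<notin> set cs \<and> distinct (concat cs) \<and> set (concat cs) = {..<n} \<and>
     \<sigma> = foldr (\<circ>) (map cycle_of_list cs) id"

definition moore_notation :: "nat \<Rightarrow> (nat \<Rightarrow> nat) \<Rightarrow> nat list list \<Rightarrow> bool" where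
  "moore_notation n \<sigma> cs \<longleftrightarrow>
     cycle_notation n \<sigma> cs \<and> (\<forall>c\<in>set cs. \<forall>x\<in>set (tl c). hd c < x) \<and>
     sorted_wrt (>) (map hd cs)"

text \<open>
  In the next definition the first cycle automatically starts with the largest index \<open>n - 1\<close>,
  since that index is the maximum, hence the head, of its own cycle.
\<close>

definition chen_notation :: "nat \<Rightarrow> (nat \<Rightarrow> nat) \<Rightarrow> nat list list \<Rightarrow> bool" where
  "chen_notation n \<sigma> cs \<longleftrightarrow>
     cycle_notation n \<sigma> cs \<and> (\<forall>c\<in>set cs. \<forall>x\<in>set (tl c). hd c > x) \<and>
     sorted_wrt (>) (map hd cs)"

definition cycle_term :: "'a::monoid_mult mat \<Rightarrow> nat list \<Rightarrow> 'a" where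
  "cycle_term A c = prod_list (map2 (\<lambda>i j. A $$ (i, j)) c (rotate1 c))"

definition perm_term :: "'a::monoid_mult mat \<Rightarrow> nat list list \<Rightarrow> 'a" where
  "perm_term A cs = prod_list (map (cycle_term A) cs)"

definition Mdet :: "'a::ring_1 mat \<Rightarrow> 'a" where
  "Mdet A =
     (\<Sum>\<sigma> | \<sigma> permutes {..<dim_row A}.
        of_int (sign \<sigma>) * perm_term A (THE cs. moore_notation (dim_row A) \<sigma> cs))"

definition Cdet :: "'a::ring_1 mat \<Rightarrow> 'a" where
  "Cdet A =
     (\<Sum>\<sigma> | \<sigma> permutes {..<dim_row A}.
        let cs = (THE cs. chen_notation (dim_row A) \<sigma> cs)
        in (- 1) ^ (dim_row A - length cs) * perm_term A cs)"

end

theory Submission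
  imports Defs
begin

text \<open>
  Both determinants equal a third expression in which nothing depends on how permutations are
  written. For a cycle \<open>c = (x k\<^sub>1 \<dots> k\<^sub>m)\<close> let \<open>a\<^sub>c = a\<^bsub>x k\<^sub>1\<^esub> a\<^bsub>k\<^sub>1 k\<^sub>2\<^esub> \<dots> a\<^bsub>k\<^sub>m x\<^esub>\<close>. Its real
  part, taken in both components of the dual quaternion, is central, and it does not depend on the
  index at which \<open>c\<close> starts, because real parts satisfy \<open>Re (p q) = Re (q p)\<close>. So
  \<open>\<Sum>\<^sub>\<sigma> sign(\<sigma>) \<Prod>\<^sub>c Re a\<^sub>c\<close>, with \<open>c\<close> running over the cycles of \<open>\<sigma>\<close>, makes sense for every
  matrix. \<open>cycle_det\<close> computes it by splitting off the cycle through the smallest index, and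
  \<open>cycle_det_expand\<close> says that any other pivot index serves as well. For a Hermitian matrix,
  reversing a cycle conjugates \<open>a\<^sub>c\<close>; the sum over the cycles through a pivot is
  therefore self-conjugate, and the real parts may be dropped (\<open>cycle_det_expand_hermitian\<close>).

  \<^bold>\<open>The two determinants.\<close> In Chen's notation the first cycle passes through the largest index; in
  Moore's notation the last cycle passes through the smallest one. Summing over that cycle and, by
  induction, over the notations of the remaining permutation gives exactly the expansion of
  \<open>cycle_det\<close> with that index as pivot. The values for smaller index sets are central, so it
  does not matter on which side the cycle is split off.

  \<^bold>\<open>The eigenvalues.\<close> The expansion without real parts yields a Laplace-type identity: a sum over
  the paths that start in \<open>i \<in> S\<close> and continue through \<open>S\<close>, weighted with the determinants of what
  the paths leave over, vanishes, since the paths that return to \<open>i\<close> cancel those that do not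
  (\<open>walk_expansion_vanishes\<close>). This is the analogue of ``a determinant with two equal rows is
  zero''. It shows that replacing the basis vector \<open>e\<^sub>j\<close> by a vector \<open>y\<close> multiplies the determinant
  of a Hermitian form by \<open>y\<^sub>j\<^sup>* y\<^sub>j\<close> (\<open>cycle_det_base_change\<close>).

  An eigenvalue list provides \<open>n\<close> eigenvectors whose standard parts are independent: within
  one eigenvalue by the definition of multiplicity, and across different eigenvalues because
  eigenvectors of a Hermitian matrix then have orthogonal standard parts. Steinitz exchange
  introduces these eigenvectors into the standard basis one at a time. In the end
  they are the columns of a matrix \<open>X\<close> with \<open>A X = X \<Lambda>\<close>, and \<open>det(X\<^sup>* B X) = N det B\<close> for every
  Hermitian \<open>B\<close>, with a fixed invertible \<open>N\<close>. Eigenvalues are dual numbers, hence central, and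
  every cycle term of \<open>X\<^sup>* A X = (X\<^sup>* X) \<Lambda>\<close> is the one of \<open>X\<^sup>* X\<close> times eigenvalues. Altogether
  \<open>N det A = det(X\<^sup>* A X) = det(X\<^sup>* X) \<Prod>\<lambda>\<^sub>i = N \<Prod>\<lambda>\<^sub>i\<close>, where the last step is the case
  \<open>B = 1\<close>.
\<close>

section \<open>Conjugation and real parts of dual quaternions\<close>

lemma quat_cnj_mult: "quat_cnj (p * q) = quat_cnj q * quat_cnj p"
  by (simp add: quat_eq_iff algebra_simps)

lemma quat_cnj_add: "quat_cnj (p + q) = quat_cnj p + quat_cnj q"
  by (simp add: quat_eq_iff)

lemma std_dq_cnj [simp]: "std (dq_cnj q) = quat_cnj (std q)"
  and inft_dq_cnj [simp]: "inft (dq_cnj q) = quat_cnj (inft q)"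
  by (simp_all add: dq_cnj_def)

lemma dq_cnj_mult: "dq_cnj (p * q) = dq_cnj q * dq_cnj p"
  by (simp add: dual_eq_iff quat_cnj_mult quat_cnj_add add.commute)

lemma dq_cnj_add: "dq_cnj (p + q) = dq_cnj p + dq_cnj q"
  by (simp add: dual_eq_iff quat_cnj_add)

lemma dq_cnj_minus: "dq_cnj (- q) = - dq_cnj q"
  by (simp add: dual_eq_iff quat_eq_iff)

lemma dq_cnj_cnj [simp]: "dq_cnj (dq_cnj q) = q"
  by (simp add: dual_eq_iff quat_eq_iff)

lemma dq_cnj_0 [simp]: "dq_cnj 0 = 0" and dq_cnj_1 [simp]: "dq_cnj 1 = 1"
  by (simp_all add: dual_eq_iff quat_eq_iff)

lemma dq_cnj_sum: "dq_cnj (sum f S) = (\<Sum>x\<in>S. dq_cnj (f x))"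
  by (induction S rule: infinite_finite_induct) (simp_all add: dq_cnj_add)

text \<open>
  The real part in both components, so that \<open>q + q\<^sup>* = 2 Re q\<close>. It is again a dual quaternion
  rather than a pair of reals, which keeps all computations inside one ring.
\<close>

definition dq_re :: "dual_quat \<Rightarrow> dual_quat" where
  "dq_re q = Dual (Quat (Re_q (std q)) 0 0 0) (Quat (Re_q (inft q)) 0 0 0)"

lemma dq_re_add: "dq_re (p + q) = dq_re p + dq_re q"
  by (simp add: dq_re_def dual_eq_iff quat_eq_iff)

lemma dq_re_minus: "dq_re (- q) = - dq_re q"
  by (simp add: dq_re_def dual_eq_iff quat_eq_iff)

lemma dq_re_0 [simp]: "dq_re 0 = 0" and dq_re_1 [simp]: "dq_re 1 = 1"
  by (simp_all add: dq_re_def dual_eq_iff quat_eq_iff)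

lemma dq_re_sum: "dq_re (sum f S) = (\<Sum>x\<in>S. dq_re (f x))"
  by (induction S rule: infinite_finite_induct) (simp_all add: dq_re_add)

lemma dq_re_re [simp]: "dq_re (dq_re q) = dq_re q"
  by (simp add: dq_re_def)

lemma dq_re_commute: "dq_re p * q = q * dq_re p"
  by (simp add: dq_re_def dual_eq_iff quat_eq_iff algebra_simps)

text \<open>
  This identity is what makes the real part of a cycle term independent of its starting point.
\<close>

lemma dq_re_mult_commute: "dq_re (p * q) = dq_re (q * p)"
  by (simp add: dq_re_def dual_eq_iff quat_eq_iff algebra_simps)

lemma dq_re_mult_re: "dq_re (p * dq_re q) = dq_re p * dq_re q"
  by (simp add: dq_re_def dual_eq_iff quat_eq_iff algebra_simps)

text \<open>
  From here on, being a dual number is expressed as \<open>dq_cnj q = q\<close>, which is convenient because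
  \<open>dq_cnj\<close> reverses products.
\<close>

lemma dq_re_eq_iff: "dq_re q = q \<longleftrightarrow> dq_cnj q = q"
  by (auto simp: dq_re_def dual_eq_iff quat_eq_iff)

lemma dq_real_commute: "dq_cnj p = p \<Longrightarrow> p * q = q * p"
  by (metis dq_re_commute dq_re_eq_iff)

lemma dq_re_mult_real: "dq_cnj q = q \<Longrightarrow> dq_re (p * q) = dq_re p * q"
  by (metis dq_re_eq_iff dq_re_mult_re)

lemma dq_cnj_re [simp]: "dq_cnj (dq_re q) = dq_re q"
  by (metis dq_re_eq_iff dq_re_re)

lemma dq_cnj_mult_real: "dq_cnj p = p \<Longrightarrow> dq_cnj q = q \<Longrightarrow> dq_cnj (p * q) = p * q"
  by (simp add: dq_cnj_mult dq_real_commute)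

section \<open>Arrangements of a finite set\<close>

definition arrangements :: "'a set \<Rightarrow> 'a list set" where
  "arrangements U = {ks. distinct ks \<and> set ks \<subseteq> U}"

lemma finite_arrangements: "finite U \<Longrightarrow> finite (arrangements U)"
  unfolding arrangements_def by (rule finite_subset[OF _ finite_subset_distinct]) auto

lemma Nil_in_arrangements [simp]: "[] \<in> arrangements U"
  by (simp add: arrangements_def)

text \<open>
  An arrangement of \<open>insert y U\<close> either avoids \<open>y\<close> or is cut at \<open>y\<close> into two disjoint arrangements.
  With \<open>sum_arrangements_swap\<close>, which exchanges the roles of the two parts, this drives both the
  independence of the pivot and the cancellation between paths below.
\<close>

lemma sum_arrangements_insert:
  fixes f :: "'a list \<Rightarrow> 'b::comm_monoid_add"
  assumes "finite U" "y \<notin> U"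
  shows "(\<Sum>ks\<in>arrangements (insert y U). f ks) =
    (\<Sum>ks\<in>arrangements U. f ks) +
    (\<Sum>ps\<in>arrangements U. \<Sum>qs\<in>arrangements (U - set ps). f (ps @ y # qs))"
proof -
  let ?P = "Sigma (arrangements U) (\<lambda>ps. arrangements (U - set ps))"
  let ?j = "\<lambda>(ps, qs). ps @ y # qs"
  have split: "arrangements (insert y U) = arrangements U \<union> ?j ` ?P"
  proof (intro equalityI subsetI)
    fix ks assume ks: "ks \<in> arrangements (insert y U)"
    show "ks \<in> arrangements U \<union> ?j ` ?P"
    proof (cases "y \<in> set ks")
      case True
      then obtain ps qs where e: "ks = ps @ y # qs" by (meson split_list)
      have "(ps, qs) \<in> ?P" using ks by (auto simp: e arrangements_def)
      then show ?thesis using e by (intro UnI2) (rule image_eqI[where x = "(ps, qs)"], auto)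
    next
      case False
      then show ?thesis using ks by (auto simp: arrangements_def)
    qed
  qed (use assms in \<open>auto simp: arrangements_def\<close>)
  have inj: "inj_on ?j ?P"
  proof (rule inj_onI, clarify)
    fix ps qs ps' qs'
    assume "ps \<in> arrangements U" "qs \<in> arrangements (U - set ps)"
      "ps' \<in> arrangements U" "qs' \<in> arrangements (U - set ps')"
      and e: "ps @ y # qs = ps' @ y # qs'"
    then have "y \<notin> set ps" "y \<notin> set qs" "y \<notin> set ps'" "y \<notin> set qs'"
      using assms(2) by (auto simp: arrangements_def)
    with e show "ps = ps' \<and> qs = qs'"
      using append_Cons_eq_iff by metis
  qed
  have fin: "finite ?P"
    using assms by (intro finite_SigmaI finite_arrangements) auto
  have "(\<Sum>ks\<in>arrangements (insert y U). f ks) = sum f (arrangements U) + sum f (?j ` ?P)"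
    unfolding split using assms fin
    by (intro sum.union_disjoint finite_arrangements finite_imageI) (auto simp: arrangements_def)
  also have "sum f (?j ` ?P) = (\<Sum>(ps, qs)\<in>?P. f (ps @ y # qs))"
    by (subst sum.reindex[OF inj]) (simp add: case_prod_unfold)
  also have "\<dots> = (\<Sum>ps\<in>arrangements U. \<Sum>qs\<in>arrangements (U - set ps). f (ps @ y # qs))"
    using assms by (subst sum.Sigma) (auto intro: finite_arrangements)
  finally show ?thesis .
qed

lemma sum_arrangements_swap:
  fixes g :: "'a list \<Rightarrow> 'a list \<Rightarrow> 'b::comm_monoid_add"
  assumes "finite U"
  shows "(\<Sum>ps\<in>arrangements U. \<Sum>qs\<in>arrangements (U - set ps). g ps qs) =
    (\<Sum>qs\<in>arrangements U. \<Sum>ps\<in>arrangements (U - set qs). g ps qs)"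
proof -
  let ?P = "Sigma (arrangements U) (\<lambda>ps. arrangements (U - set ps))"
  have "(\<Sum>ps\<in>arrangements U. \<Sum>qs\<in>arrangements (U - set ps). g ps qs) = (\<Sum>(ps, qs)\<in>?P. g ps qs)"
    using assms by (subst sum.Sigma) (auto intro: finite_arrangements)
  also have "\<dots> = (\<Sum>(qs, ps)\<in>?P. g ps qs)"
    by (rule sum.reindex_bij_witness[where i = prod.swap and j = prod.swap])
      (auto simp: arrangements_def)
  also have "\<dots> = (\<Sum>qs\<in>arrangements U. \<Sum>ps\<in>arrangements (U - set qs). g ps qs)"
    using assms by (subst sum.Sigma) (auto intro: finite_arrangements)
  finally show ?thesis .
qed

lemma sum_arrangements_rev:
  "(\<Sum>ks\<in>arrangements U. f (rev ks)) = (\<Sum>ks\<in>arrangements U. f ks)"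
  by (rule sum.reindex_bij_witness[where i = rev and j = rev]) (auto simp: arrangements_def)

section \<open>Weights of paths\<close>

text \<open>
  The weight of a path from \<open>x\<close> through the listed indices, with a sign for each step and with an
  arbitrary column \<open>v\<close> read off at the last index. Taking \<open>v\<close> to be column \<open>y\<close> of the matrix closes
  the path at \<open>y\<close>. A cycle with \<open>m + 1\<close> elements then carries the sign \<open>(-1)\<^sup>m\<close>, which is the sign of
  the cyclic permutation, so no signs have to be tracked separately.
\<close>

fun walk :: "('a \<Rightarrow> 'a \<Rightarrow> 'b::ring_1) \<Rightarrow> 'a \<Rightarrow> 'a list \<Rightarrow> ('a \<Rightarrow> 'b) \<Rightarrow> 'b" where
  "walk a x [] v = v x"
| "walk a x (k # ks) v = - (a x k * walk a k ks v)"

abbreviation path_weight :: "('a \<Rightarrow> 'a \<Rightarrow> 'b::ring_1) \<Rightarrow> 'a \<Rightarrow> 'a list \<Rightarrow> 'a \<Rightarrow> 'b" where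
  "path_weight a x ks y \<equiv> walk a x ks (\<lambda>k. a k y)"

lemma walk_append: "walk a x (ps @ y # qs) v = - (path_weight a x ps y * walk a y qs v)"
  by (induction ps arbitrary: x) (simp_all add: mult.assoc)

lemma walk_sum:
  "walk a x ks (\<lambda>k. \<Sum>l\<in>L. a k l * y l) = (\<Sum>l\<in>L. path_weight a x ks l * y l)"
  by (induction ks arbitrary: x) (simp_all add: sum_distrib_left mult.assoc sum_negf)

lemma walk_cong:
  assumes "\<And>k l. k \<in> insert x (set ks) \<Longrightarrow> l \<in> set ks \<Longrightarrow> a k l = b k l"
    "\<And>k. k \<in> insert x (set ks) \<Longrightarrow> v k = w k"
  shows "walk a x ks v = walk b x ks w"
  using assms by (induction ks arbitrary: x) auto

definition hermitian_on :: "nat set \<Rightarrow> (nat \<Rightarrow> nat \<Rightarrow> dual_quat) \<Rightarrow> bool" where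
  "hermitian_on S a \<longleftrightarrow> (\<forall>i\<in>S. \<forall>j\<in>S. dq_cnj (a i j) = a j i)"

lemma hermitian_on_subset: "hermitian_on S a \<Longrightarrow> T \<subseteq> S \<Longrightarrow> hermitian_on T a"
  by (auto simp: hermitian_on_def)

lemma cnj_path_weight:
  assumes "hermitian_on (insert x (insert y (set ks))) a"
  shows "dq_cnj (path_weight a x ks y) = path_weight a y (rev ks) x"
  using assms
proof (induction ks arbitrary: x)
  case Nil
  then show ?case by (simp add: hermitian_on_def)
next
  case (Cons k ks)
  have "dq_cnj (path_weight a k ks y) = path_weight a y (rev ks) k"
    by (rule Cons.IH) (rule hermitian_on_subset[OF Cons.prems], auto)
  moreover have "dq_cnj (a x k) = a k x"
    using Cons.prems by (simp add: hermitian_on_def)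
  ultimately show ?case
    by (simp add: dq_cnj_minus dq_cnj_mult walk_append)
qed

section \<open>The sum over products of real parts of cycles\<close>

text \<open>
  The sum \<open>\<Sum>\<^sub>\<sigma> sign(\<sigma>) \<Prod>\<^sub>c Re a\<^sub>c\<close> over the permutations of \<open>S\<close>, organized by the cycle through the
  smallest element. Infinite sets get the value \<open>1\<close> by default.
\<close>

function cycle_det :: "(nat \<Rightarrow> nat \<Rightarrow> dual_quat) \<Rightarrow> nat set \<Rightarrow> dual_quat" where
  "cycle_det a S = (if finite S \<and> S \<noteq> {} then
     \<Sum>ks\<in>arrangements (S - {Min S}).
       dq_re (path_weight a (Min S) ks (Min S)) * cycle_det a (S - {Min S} - set ks)
     else 1)"
  by auto
termination
proof (relation "measure (\<lambda>(a, S). card S)")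
  fix a :: "nat \<Rightarrow> nat \<Rightarrow> dual_quat" and S :: "nat set" and ks :: "nat list"
  assume "finite S \<and> S \<noteq> {}"
  then have "card (S - {Min S} - set ks) < card S"
    by (intro psubset_card_mono) (use Min_in in blast)+
  then show "((a, S - {Min S} - set ks), (a, S)) \<in> measure (\<lambda>(a, S). card S)" by simp
qed simp

declare cycle_det.simps [simp del]

lemma cycle_det_empty [simp]: "cycle_det a {} = 1"
  by (simp add: cycle_det.simps)

lemma cycle_det_Min:
  "finite S \<Longrightarrow> S \<noteq> {} \<Longrightarrow> cycle_det a S = (\<Sum>ks\<in>arrangements (S - {Min S}).
     dq_re (path_weight a (Min S) ks (Min S)) * cycle_det a (S - {Min S} - set ks))"
  by (subst cycle_det.simps) simp

lemma cycle_det_infinite: "infinite S \<Longrightarrow> cycle_det a S = 1"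
  by (subst cycle_det.simps) simp

lemma cnj_cycle_det [simp]: "dq_cnj (cycle_det a S) = cycle_det a S"
proof (induction a S rule: cycle_det.induct)
  case (1 a S)
  show ?case
  proof (cases "finite S \<and> S \<noteq> {}")
    case True
    then show ?thesis
      by (simp add: cycle_det_Min dq_cnj_sum 1 dq_cnj_mult_real)
  qed (auto simp: cycle_det_infinite)
qed

lemma cycle_det_commute: "cycle_det a S * q = q * cycle_det a S"
  by (rule dq_real_commute) simp

lemma cycle_det_cong:
  assumes "\<And>i j. i \<in> S \<Longrightarrow> j \<in> S \<Longrightarrow> a i j = b i j"
  shows "cycle_det a S = cycle_det b S"
  using assms
proof (induction a S rule: cycle_det.induct)
  case (1 a S)
  show ?case
  proof (cases "finite S \<and> S \<noteq> {}")
    case True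
    then have Min: "Min S \<in> S" by simp
    have "walk a (Min S) ks (\<lambda>k. a k (Min S)) = walk b (Min S) ks (\<lambda>k. b k (Min S))"
      if "ks \<in> arrangements (S - {Min S})" for ks
      using that Min by (intro walk_cong 1(2)) (auto simp: arrangements_def)
    moreover have "cycle_det a (S - {Min S} - set ks) = cycle_det b (S - {Min S} - set ks)"
      if "ks \<in> arrangements (S - {Min S})" for ks
      using 1(1)[OF True that] 1(2) by auto
    ultimately show ?thesis
      using True by (simp add: cycle_det_Min)
  qed (auto simp: cycle_det_infinite)
qed

text \<open>
  The expansion along the pivot \<open>x\<close>, refined by a second index \<open>y\<close>: either \<open>y\<close> lies on another
  cycle, which is split off next, or the cycle of \<open>x\<close> passes through \<open>y\<close> and falls into a path from
  \<open>x\<close> to \<open>y\<close> and a path back. The result is symmetric in \<open>x\<close> and \<open>y\<close>: in the first case because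
  real parts commute, in the second because of \<open>Re (p q) = Re (q p)\<close>.
\<close>

lemma cycle_expansion_split:
  assumes fin: "finite U" and xy: "y \<notin> U"
    and exp: "\<And>T. T \<subseteq> U \<Longrightarrow> cycle_det a (insert y T) =
      (\<Sum>ks\<in>arrangements T. dq_re (path_weight a y ks y) * cycle_det a (T - set ks))"
  shows "(\<Sum>ks\<in>arrangements (insert y U).
      dq_re (path_weight a x ks x) * cycle_det a (insert y U - set ks)) =
    (\<Sum>ps\<in>arrangements U. \<Sum>qs\<in>arrangements (U - set ps).
      dq_re (path_weight a x ps x) * dq_re (path_weight a y qs y) * cycle_det a (U - set ps - set qs)) +
    (\<Sum>ps\<in>arrangements U. \<Sum>qs\<in>arrangements (U - set ps).
      - (dq_re (path_weight a x ps y * path_weight a y qs x) * cycle_det a (U - set ps - set qs)))"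
proof -
  have "dq_re (path_weight a x ps x) * cycle_det a (insert y U - set ps) =
    (\<Sum>qs\<in>arrangements (U - set ps).
      dq_re (path_weight a x ps x) * dq_re (path_weight a y qs y) * cycle_det a (U - set ps - set qs))"
    if "ps \<in> arrangements U" for ps
  proof -
    have "insert y U - set ps = insert y (U - set ps)"
      using that xy by (auto simp: arrangements_def)
    then show ?thesis by (simp add: exp sum_distrib_left mult.assoc)
  qed
  moreover have "insert y U - set (ps @ y # qs) = U - set ps - set qs" for ps qs
    using xy by auto
  ultimately show ?thesis
    by (subst sum_arrangements_insert[OF fin xy]) (simp add: walk_append dq_re_minus)
qed

lemma cycle_expansion_swap:
  assumes fin: "finite U" and xy: "x \<notin> U" "y \<notin> U"
    and exp: "\<And>z T. z \<in> {x, y} \<Longrightarrow> T \<subseteq> U \<Longrightarrow> cycle_det a (insert z T) =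
      (\<Sum>ks\<in>arrangements T. dq_re (path_weight a z ks z) * cycle_det a (T - set ks))"
  shows "(\<Sum>ks\<in>arrangements (insert y U).
      dq_re (path_weight a x ks x) * cycle_det a (insert y U - set ks)) =
    (\<Sum>ks\<in>arrangements (insert x U).
      dq_re (path_weight a y ks y) * cycle_det a (insert x U - set ks))"
proof -
  have comm: "U - set ps - set qs = U - set qs - set ps" for ps qs :: "nat list" by auto
  have expx: "cycle_det a (insert x T) =
      (\<Sum>ks\<in>arrangements T. dq_re (path_weight a x ks x) * cycle_det a (T - set ks))"
    and expy: "cycle_det a (insert y T) =
      (\<Sum>ks\<in>arrangements T. dq_re (path_weight a y ks y) * cycle_det a (T - set ks))"
    if "T \<subseteq> U" for T
    using exp that by blast+
  show ?thesis
    unfolding cycle_expansion_split[OF fin xy(2) expy, simplified]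
      cycle_expansion_split[OF fin xy(1) expx, simplified]
    apply (subst (1 2) sum_arrangements_swap[OF fin])
    apply (intro arg_cong2[where f = "(+)"] sum.cong refl)
    subgoal for qs ps by (simp only: comm[of qs ps] dq_re_commute[of "path_weight a y qs y" "dq_re (path_weight a x ps x)"])
    subgoal for qs ps by (simp only: comm[of qs ps] dq_re_mult_commute[of "path_weight a y qs x" "path_weight a x ps y"])
    done
qed

text \<open>
  Independence of the pivot. By induction smaller sets may be expanded along any of their elements,
  so \<open>cycle_expansion_swap\<close> compares the pivot \<open>x\<close> with the minimum \<open>m\<close>.
\<close>

theorem cycle_det_expand:
  assumes "finite T" "x \<notin> T"
  shows "cycle_det a (insert x T) =
    (\<Sum>ks\<in>arrangements T. dq_re (path_weight a x ks x) * cycle_det a (T - set ks))"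
  using assms
proof (induction "card T" arbitrary: T x rule: less_induct)
  case less
  define m where "m = Min (insert x T)"
  have m: "m \<in> insert x T" unfolding m_def using less.prems by (intro Min_in) auto
  have def: "cycle_det a (insert x T) = (\<Sum>ks\<in>arrangements (insert x T - {m}).
      dq_re (path_weight a m ks m) * cycle_det a (insert x T - {m} - set ks))"
    using less.prems by (subst cycle_det.simps) (simp add: m_def)
  show ?case
  proof (cases "m = x")
    case True
    then show ?thesis using def less.prems by simp
  next
    case False
    define U where "U = T - {m}"
    have T: "T = insert m U" and mU: "m \<notin> U" using m False by (auto simp: U_def)
    have xU: "x \<notin> U" and fU: "finite U" using less.prems by (auto simp: U_def)
    have xm: "insert x T - {m} = insert x U" using False mU by (auto simp: T)
    have "cycle_det a (insert z V) =
        (\<Sum>ks\<in>arrangements V. dq_re (path_weight a z ks z) * cycle_det a (V - set ks))"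
      if "z \<in> {x, m}" "V \<subseteq> U" for z V
    proof (rule less.hyps)
      show "card V < card T" using that fU mU unfolding T
        by (intro psubset_card_mono) auto
    qed (use that fU xU mU in \<open>auto intro: finite_subset\<close>)
    from cycle_expansion_swap[OF fU xU mU this]
    show ?thesis unfolding def xm by (simp add: T)
  qed
qed

section \<open>Hermitian matrices: expansion and change of basis\<close>

text \<open>
  The sum without real parts is self-conjugate: conjugation replaces each cycle by its reversal,
  which is again a cycle through \<open>x\<close> on the same set. Hence it agrees with its real part.
\<close>

lemma cycle_det_expand_hermitian:
  assumes "finite T" "x \<notin> T" and herm: "hermitian_on (insert x T) a"
  shows "cycle_det a (insert x T) =
    (\<Sum>ks\<in>arrangements T. path_weight a x ks x * cycle_det a (T - set ks))" (is "_ = ?F")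
proof -
  have "dq_cnj ?F = (\<Sum>ks\<in>arrangements T. path_weight a x (rev ks) x * cycle_det a (T - set (rev ks)))"
    unfolding dq_cnj_sum
  proof (intro sum.cong refl)
    fix ks assume "ks \<in> arrangements T"
    then have "hermitian_on (insert x (insert x (set ks))) a"
      by (intro hermitian_on_subset[OF herm]) (auto simp: arrangements_def)
    then show "dq_cnj (path_weight a x ks x * cycle_det a (T - set ks)) =
        path_weight a x (rev ks) x * cycle_det a (T - set (rev ks))"
      by (simp add: dq_cnj_mult cnj_path_weight cycle_det_commute)
  qed
  also have "\<dots> = ?F"
    by (rule sum_arrangements_rev)
  finally have "?F = dq_re ?F" unfolding dq_re_eq_iff[symmetric] ..
  also have "\<dots> = (\<Sum>ks\<in>arrangements T. dq_re (path_weight a x ks x) * cycle_det a (T - set ks))"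
    by (simp add: dq_re_sum dq_re_mult_real)
  finally show ?thesis
    using assms by (simp add: cycle_det_expand)
qed

text \<open>
  For \<open>i \<in> S\<close>, a path from \<open>i\<close> through \<open>S\<close> either avoids \<open>i\<close> or returns to it once. In the first case
  the remaining determinant contains \<open>i\<close> and is expanded along \<open>i\<close>, which splits off a cycle at \<open>i\<close>; in
  the second case the path already consists of such a cycle followed by a path that avoids \<open>i\<close>. Both
  cases produce the same terms, with opposite signs, because closing the cycle inside the path
  costs one further step.
\<close>

lemma walk_expansion_vanishes:
  assumes fin: "finite S" and i: "i \<in> S" and herm: "hermitian_on S a"
  shows "(\<Sum>ks\<in>arrangements S. walk a i ks v * cycle_det a (S - set ks)) = 0"
proof -
  define U where "U = S - {i}"
  have S: "S = insert i U" and iU: "i \<notin> U" and fU: "finite U"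
    using i fin by (auto simp: U_def)
  let ?d = "\<lambda>ps qs. cycle_det a (U - set ps - set qs)"
  have avoid: "walk a i qs v * cycle_det a (S - set qs) =
      (\<Sum>ps\<in>arrangements (U - set qs). path_weight a i ps i * walk a i qs v * ?d ps qs)"
    if "qs \<in> arrangements U" for qs
  proof -
    have "S - set qs = insert i (U - set qs)"
      using that iU by (auto simp: S arrangements_def)
    moreover have "hermitian_on (insert i (U - set qs)) a"
      by (rule hermitian_on_subset[OF herm]) (auto simp: S)
    ultimately have "cycle_det a (S - set qs) =
        (\<Sum>ps\<in>arrangements (U - set qs). path_weight a i ps i * cycle_det a (U - set qs - set ps))"
      using fU iU by (simp add: cycle_det_expand_hermitian)
    then have "walk a i qs v * cycle_det a (S - set qs) =
        (\<Sum>ps\<in>arrangements (U - set qs). path_weight a i ps i * cycle_det a (U - set qs - set ps)) * walk a i qs v"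
      by (metis cycle_det_commute)
    also have "\<dots> = (\<Sum>ps\<in>arrangements (U - set qs). path_weight a i ps i * walk a i qs v * ?d ps qs)"
      unfolding sum_distrib_right
    proof (intro sum.cong refl)
      fix ps
      have "U - set qs - set ps = U - set ps - set qs" by auto
      then show "path_weight a i ps i * cycle_det a (U - set qs - set ps) * walk a i qs v =
          path_weight a i ps i * walk a i qs v * ?d ps qs"
        by (simp add: mult.assoc cycle_det_commute)
    qed
    finally show ?thesis .
  qed
  have pass: "walk a i (ps @ i # qs) v * cycle_det a (S - set (ps @ i # qs)) =
      - (path_weight a i ps i * walk a i qs v * ?d ps qs)" for ps qs
  proof -
    have "S - set (ps @ i # qs) = U - set ps - set qs" using iU by (auto simp: S)
    then show ?thesis by (simp add: walk_append)
  qed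
  have "(\<Sum>ks\<in>arrangements S. walk a i ks v * cycle_det a (S - set ks)) =
    (\<Sum>qs\<in>arrangements U. \<Sum>ps\<in>arrangements (U - set qs). path_weight a i ps i * walk a i qs v * ?d ps qs) +
    (\<Sum>ps\<in>arrangements U. \<Sum>qs\<in>arrangements (U - set ps). - (path_weight a i ps i * walk a i qs v * ?d ps qs))"
    unfolding S by (subst sum_arrangements_insert[OF fU iU]) (simp only: avoid[unfolded S] pass[unfolded S] cong: sum.cong)
  also have "\<dots> = 0"
    by (subst sum_arrangements_swap[OF fU, symmetric]) (simp add: sum_negf)
  finally show ?thesis .
qed

text \<open>
  Here \<open>b\<close> is the Hermitian form \<open>a\<close> after replacing the basis vector \<open>e\<^sub>j\<close> by \<open>y\<close>. In the expansion
  of \<open>b\<close> along \<open>j\<close>, only the first and the last factor of each cycle involve \<open>y\<close>, so the sum is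
  \<open>\<Sum>\<^sub>i \<Sum>\<^sub>l y\<^sub>i\<^sup>* K\<^sub>i\<^sub>l y\<^sub>l\<close>, where \<open>K\<^sub>i\<^sub>l\<close> sums the paths from \<open>i\<close> to \<open>l\<close> through the other indices. By
  \<open>walk_expansion_vanishes\<close> and its conjugate, only \<open>K\<^sub>j\<^sub>j = det a\<close> survives.
\<close>

lemma cycle_det_base_change:
  fixes a :: "nat \<Rightarrow> nat \<Rightarrow> dual_quat"
  assumes fin: "finite S" and j: "j \<in> S" and herm: "hermitian_on S a"
    and v: "\<And>k. k \<in> S \<Longrightarrow> v k = (\<Sum>l\<in>S. a k l * y l)"
    and b: "\<And>i k. i \<in> S - {j} \<Longrightarrow> k \<in> S - {j} \<Longrightarrow> b i k = a i k"
      "\<And>i. i \<in> S - {j} \<Longrightarrow> b i j = v i"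
      "\<And>k. k \<in> S - {j} \<Longrightarrow> b j k = (\<Sum>i\<in>S. dq_cnj (y i) * a i k)"
      "b j j = (\<Sum>i\<in>S. dq_cnj (y i) * v i)"
    and hermb: "hermitian_on S b"
  shows "cycle_det b S = dq_cnj (y j) * y j * cycle_det a S"
proof -
  define T where "T = S - {j}"
  have S: "S = insert j T" and jT: "j \<notin> T" and fT: "finite T"
    using j fin by (auto simp: T_def)
  have hermT: "hermitian_on T a" by (rule hermitian_on_subset[OF herm]) (auto simp: S)
  note bT = b[folded T_def]
  define K where "K x l = (\<Sum>ks\<in>arrangements T. path_weight a x ks l * cycle_det a (T - set ks))" for x l
  have walk_b: "walk b k ks (\<lambda>k. b k j) = walk a k ks v" if "k \<in> T" "set ks \<subseteq> T" for k ks
    using that by (intro walk_cong) (auto intro!: bT)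
  have path_b: "path_weight b j ks j = (\<Sum>i\<in>S. dq_cnj (y i) * walk a i ks v)"
    if "ks \<in> arrangements T" for ks
    using that
  proof (cases ks)
    case Nil
    then show ?thesis by (simp add: b(4))
  next
    case (Cons k ls)
    with that have "k \<in> T" "set ls \<subseteq> T" by (auto simp: arrangements_def)
    then show ?thesis
      by (simp add: Cons walk_b bT sum_distrib_right sum_negf mult.assoc)
  qed
  have walk_v: "walk a i ks v = (\<Sum>l\<in>S. path_weight a i ks l * y l)"
    if "i \<in> S" "ks \<in> arrangements T" for i ks
  proof -
    have "walk a i ks v = walk a i ks (\<lambda>k. \<Sum>l\<in>S. a k l * y l)"
      using that by (intro walk_cong) (auto simp: v arrangements_def S)
    then show ?thesis by (simp add: walk_sum)
  qed
  have K_row: "K i l = 0" if "i \<in> T" for i l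
    unfolding K_def using walk_expansion_vanishes[OF fT that hermT] .
  have K_col: "K j l = 0" if "l \<in> T" for l
  proof -
    have "dq_cnj (K j l) = (\<Sum>ks\<in>arrangements T. path_weight a l (rev ks) j * cycle_det a (T - set (rev ks)))"
      unfolding K_def dq_cnj_sum
    proof (intro sum.cong refl)
      fix ks assume "ks \<in> arrangements T"
      then have "hermitian_on (insert j (insert l (set ks))) a"
        using that by (intro hermitian_on_subset[OF herm]) (auto simp: arrangements_def S)
      then show "dq_cnj (path_weight a j ks l * cycle_det a (T - set ks)) =
          path_weight a l (rev ks) j * cycle_det a (T - set (rev ks))"
        by (simp add: dq_cnj_mult cnj_path_weight cycle_det_commute)
    qed
    also have "\<dots> = K l j" unfolding K_def by (rule sum_arrangements_rev)
    finally show ?thesis using K_row[OF that] by (metis dq_cnj_0 dq_cnj_cnj)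
  qed
  have K_diag: "K j j = cycle_det a S"
    unfolding K_def S using herm by (simp add: S cycle_det_expand_hermitian[OF fT jT])
  have "cycle_det b S = (\<Sum>ks\<in>arrangements T. path_weight b j ks j * cycle_det a (T - set ks))"
  proof -
    have "cycle_det b (T - set ks) = cycle_det a (T - set ks)" for ks
      by (rule cycle_det_cong) (auto simp: bT)
    then show ?thesis
      using hermb cycle_det_expand_hermitian[OF fT jT, of b] by (simp add: S)
  qed
  also have "\<dots> = (\<Sum>ks\<in>arrangements T. \<Sum>i\<in>S. \<Sum>l\<in>S.
      dq_cnj (y i) * (path_weight a i ks l * cycle_det a (T - set ks)) * y l)"
    by (intro sum.cong refl) (simp add: path_b walk_v sum_distrib_left sum_distrib_right mult.assoc cycle_det_commute[of a _ "y _"])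
  also have "\<dots> = (\<Sum>i\<in>S. \<Sum>l\<in>S. dq_cnj (y i) * K i l * y l)"
    unfolding K_def sum_distrib_left sum_distrib_right
    by (subst sum.swap) (intro sum.cong refl sum.swap)
  also have "\<dots> = dq_cnj (y j) * K j j * y j"
  proof -
    have "(\<Sum>l\<in>S. dq_cnj (y i) * K i l * y l) = (if i = j then dq_cnj (y j) * K j j * y j else 0)"
      if "i \<in> S" for i
    proof (cases "i = j")
      case True
      have "(\<Sum>l\<in>T. dq_cnj (y i) * K i l * y l) = 0"
        by (rule sum.neutral) (auto simp: True K_col)
      then show ?thesis using True fT jT by (simp add: S)
    qed (use that in \<open>simp add: S K_row\<close>)
    then show ?thesis using fin j by (simp cong: sum.cong)
  qed
  finally show ?thesis
    unfolding K_diag by (simp add: mult.assoc cycle_det_commute[of a S "y j"])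
qed

section \<open>Permutations as ordered products of cycles\<close>

definition cycles_perm :: "'a list list \<Rightarrow> 'a \<Rightarrow> 'a" where
  "cycles_perm cs = foldr (\<circ>) (map cycle_of_list cs) id"

lemma cycles_perm_simps [simp]:
  "cycles_perm [] = id" "cycles_perm (c # cs) = cycle_of_list c \<circ> cycles_perm cs"
  by (simp_all add: cycles_perm_def)

lemma cycles_perm_permutes: "cycles_perm cs permutes set (concat cs)"
proof (induction cs)
  case Nil
  then show ?case using permutes_id[of "{}"] by (simp only: cycles_perm_simps concat.simps list.set)
next
  case (Cons c cs)
  have "cycle_of_list c permutes set (concat (c # cs))"
    by (rule permutes_subset[OF cycle_permutes]) simp
  moreover have "cycles_perm cs permutes set (concat (c # cs))"
    by (rule permutes_subset[OF Cons.IH]) simp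
  ultimately show ?case
    unfolding cycles_perm_simps by (rule permutes_compose[rotated])
qed

lemma cycles_perm_append: "cycles_perm (cs @ ds) = cycles_perm cs \<circ> cycles_perm ds"
  by (induction cs) (simp_all add: comp_assoc)

lemma cycle_cycles_perm_commute:
  assumes "distinct (concat (c # cs))"
  shows "cycle_of_list c \<circ> cycles_perm cs = cycles_perm cs \<circ> cycle_of_list c"
  using assms
proof (induction cs)
  case (Cons d cs)
  have "cycle_of_list c \<circ> cycle_of_list d = cycle_of_list d \<circ> cycle_of_list c"
    using Cons.prems by (intro cycles_commute) auto
  moreover have "cycle_of_list c \<circ> cycles_perm cs = cycles_perm cs \<circ> cycle_of_list c"
    using Cons.prems by (intro Cons.IH) auto
  ultimately show ?case by (metis comp_assoc cycles_perm_simps(2))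
qed simp

lemma cycles_perm_rev:
  "distinct (concat cs) \<Longrightarrow> cycles_perm (rev cs) = cycles_perm cs"
proof (induction cs)
  case (Cons c cs)
  then show ?case
    using cycle_cycles_perm_commute[of c cs] by (simp add: cycles_perm_append)
qed simp

lemma distinct_concat_rev [simp]: "distinct (concat (rev cs)) \<longleftrightarrow> distinct (concat cs)"
  by (induction cs) auto

lemma sign_cycle_of_list: "distinct c \<Longrightarrow> sign (cycle_of_list c) = (- 1) ^ (length c - 1)"
proof (induction c rule: cycle_of_list.induct)
  case (1 i j cs)
  then show ?case
    using sign_compose[OF permutation_swap_id permutation_of_cycle, of i j "j # cs"]
    by (simp add: sign_swap_id comp_def)
qed simp_all

lemma sign_cycles_perm:
  "distinct (concat cs) \<Longrightarrow> [] \<notin> set cs \<Longrightarrow>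
    sign (cycles_perm cs) = (- 1) ^ (length (concat cs) + length cs)"
proof (induction cs)
  case (Cons c cs)
  have "permutation (cycles_perm cs)"
    using cycles_perm_permutes[of cs] by (auto simp: permutation_permutes)
  moreover obtain x ks where "c = x # ks" using Cons.prems by (cases c) auto
  ultimately show ?case
    using Cons sign_compose[OF permutation_of_cycle, of "cycles_perm cs" c]
    by (simp add: sign_cycle_of_list power_add comp_def)
qed simp

section \<open>Canonical cycle notations\<close>

definition strict_order :: "('a \<Rightarrow> 'a \<Rightarrow> bool) \<Rightarrow> bool" where
  "strict_order R \<longleftrightarrow> asymp R \<and> transp R \<and> totalp R"

lemma strict_order_less: "strict_order ((<) :: nat \<Rightarrow> nat \<Rightarrow> bool)"
  and strict_order_greater: "strict_order ((>) :: nat \<Rightarrow> nat \<Rightarrow> bool)"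
  by (auto simp: strict_order_def asymp_on_def transp_on_def totalp_on_def)

text \<open>
  A common form of both notations. Chen's notation is the case \<open>R = (>)\<close>. In Moore's notation the
  heads of the cycles are minimal but decrease, so it is the reversal of a canonical notation
  for \<open>R = (<)\<close>. In either case the first cycle of the canonical notation starts with the
  \<open>R\<close>-least element of \<open>S\<close>.
\<close>

definition canonical :: "('a \<Rightarrow> 'a \<Rightarrow> bool) \<Rightarrow> 'a set \<Rightarrow> 'a list list set" where
  "canonical R S = {cs. [] \<notin> set cs \<and> distinct (concat cs) \<and> set (concat cs) = S \<and>
     (\<forall>c\<in>set cs. \<forall>x\<in>set (tl c). R (hd c) x) \<and> sorted_wrt R (map hd cs)}"

lemma canonical_empty [simp]: "canonical R {} = {[]}"
  by (auto simp: canonical_def) (metis list.set_intros(1) neq_Nil_conv)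

lemma least_element_exists:
  assumes "strict_order R" "finite S" "S \<noteq> {}"
  obtains x where "x \<in> S" "\<forall>y\<in>S - {x}. R x y"
  using Finite_Set.bex_least_element[of S R] assms
  by (auto simp: strict_order_def intro: asymp_on_subset transp_on_subset totalp_on_subset)

text \<open>
  The head of the first cycle precedes all other heads, hence everything else, so it is the least
  element \<open>x\<close>. The rest of the first cycle is an arbitrary arrangement, and the other cycles form
  a canonical notation on what is left.
\<close>

lemma canonical_step:
  assumes R: "strict_order R" and x: "x \<in> S" "\<forall>y\<in>S - {x}. R x y"
  shows "canonical R S =
    (\<Union>ks\<in>arrangements (S - {x}). (\<lambda>cs. (x # ks) # cs) ` canonical R (S - {x} - set ks))"
proof (intro equalityI subsetI)
  fix cs assume cs: "cs \<in> canonical R S"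
  then obtain h ks ds where e: "cs = (h # ks) # ds"
    using x(1) by (cases cs; cases "hd cs") (auto simp: canonical_def)
  have trans: "R u w" if "R u v" "R v w" for u v w
    using R that unfolding strict_order_def by (blast dest: transpD)
  have "R h z" if z: "z \<in> S - {h}" for z
  proof (cases "z \<in> set ks")
    case True
    then show ?thesis using cs by (auto simp: canonical_def e)
  next
    case False
    then obtain d where d: "d \<in> set ds" "z \<in> set d"
      using z cs by (auto simp: canonical_def e)
    then have "R h (hd d)" using cs by (auto simp: canonical_def e)
    moreover have "z = hd d \<or> R (hd d) z"
    proof -
      have "\<forall>y\<in>set (tl d). R (hd d) y" using cs d by (auto simp: canonical_def e)
      then show ?thesis using d(2) by (cases d) auto
    qed
    ultimately show ?thesis using trans by blast
  qed
  moreover have "h \<in> S" using cs by (auto simp: canonical_def e)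
  ultimately have "h = x"
    using x R unfolding strict_order_def by (metis asympD Diff_iff singletonD)
  then show "cs \<in> (\<Union>ks\<in>arrangements (S - {x}). (\<lambda>cs. (x # ks) # cs) ` canonical R (S - {x} - set ks))"
    using cs by (intro UN_I[of ks] image_eqI[of _ _ ds]) (auto simp: canonical_def arrangements_def e)
next
  fix cs
  assume "cs \<in> (\<Union>ks\<in>arrangements (S - {x}). (\<lambda>cs. (x # ks) # cs) ` canonical R (S - {x} - set ks))"
  then obtain ks ds where e: "cs = (x # ks) # ds" and ks: "ks \<in> arrangements (S - {x})"
    and ds: "ds \<in> canonical R (S - {x} - set ks)" by auto
  have "hd d \<in> S - {x}" if "d \<in> set ds" for d
  proof -
    have "d \<noteq> []" using that ds by (auto simp: canonical_def)
    then have "hd d \<in> set d" by simp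
    then show ?thesis using that ds by (auto simp: canonical_def)
  qed
  then show "cs \<in> canonical R S"
    using ks ds x by (auto simp: canonical_def arrangements_def e)
qed

lemma finite_canonical:
  assumes "strict_order R" "finite S" shows "finite (canonical R S)"
  using assms(2)
proof (induction "card S" arbitrary: S rule: less_induct)
  case less
  show ?case
  proof (cases "S = {}")
    case False
    obtain x where x: "x \<in> S" "\<forall>y\<in>S - {x}. R x y"
      using least_element_exists[OF assms(1) less.prems False] by blast
    have "finite (canonical R (S - {x} - set ks))" for ks
      by (intro less.hyps psubset_card_mono) (use x less.prems in auto)
    then show ?thesis
      using less.prems by (subst canonical_step[OF assms(1) x]) (auto intro: finite_arrangements)
  qed simp
qed

lemma sum_canonical_step:
  fixes G :: "'a list list \<Rightarrow> 'b::comm_monoid_add"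
  assumes R: "strict_order R" and fin: "finite S"
    and x: "x \<in> S" "\<forall>y\<in>S - {x}. R x y"
  shows "(\<Sum>cs\<in>canonical R S. G cs) =
    (\<Sum>ks\<in>arrangements (S - {x}). \<Sum>cs\<in>canonical R (S - {x} - set ks). G ((x # ks) # cs))"
proof -
  have "(\<Sum>cs\<in>canonical R S. G cs) =
    (\<Sum>ks\<in>arrangements (S - {x}). sum G ((\<lambda>cs. (x # ks) # cs) ` canonical R (S - {x} - set ks)))"
    unfolding canonical_step[OF R x] using fin R
    by (intro sum.UNION_disjoint) (auto intro: finite_arrangements finite_canonical)
  also have "\<dots> = (\<Sum>ks\<in>arrangements (S - {x}). \<Sum>cs\<in>canonical R (S - {x} - set ks). G ((x # ks) # cs))"
    by (rule sum.cong[OF refl]) (subst sum.reindex, auto simp: inj_on_def)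
  finally show ?thesis .
qed

text \<open>
  A cycle with a given head lists the iterates of the permutation at that head, and its
  length is the period of the head. Both facts together make the cycle unique.
\<close>

lemma nth_cycle_funpow:
  assumes c: "distinct (x # ks)" and \<sigma>: "\<forall>z\<in>set (x # ks). \<sigma> z = cycle_of_list (x # ks) z"
  shows "i \<le> length ks \<Longrightarrow> (x # ks) ! i = (\<sigma> ^^ i) x" and "(\<sigma> ^^ Suc (length ks)) x = x"
proof -
  have step: "\<sigma> ((x # ks) ! i) = (x # ks) ! (Suc i mod length (x # ks))" if "i \<le> length ks" for i
  proof -
    have "map (cycle_of_list (x # ks)) (x # ks) = rotate1 (x # ks)"
      using cyclic_rotation[OF c, of 1] by simp
    then have "map (cycle_of_list (x # ks)) (x # ks) ! i = rotate1 (x # ks) ! i" by simp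
    then show ?thesis
      using that \<sigma>[rule_format, OF nth_mem, of i]
      by (simp add: nth_rotate1 del: rotate1.simps cycle_of_list.simps list.map)
  qed
  show nth: "i \<le> length ks \<Longrightarrow> (x # ks) ! i = (\<sigma> ^^ i) x" for i
  proof (induction i)
    case (Suc i)
    then show ?case using step[of i] by simp
  qed simp
  show "(\<sigma> ^^ Suc (length ks)) x = x"
    using step[of "length ks"] nth[of "length ks"] by simp
qed

lemma cycle_through_unique:
  assumes "distinct (x # ks)" "\<forall>z\<in>set (x # ks). \<sigma> z = cycle_of_list (x # ks) z"
    and "distinct (x # ls)" "\<forall>z\<in>set (x # ls). \<sigma> z = cycle_of_list (x # ls) z"
  shows "ks = ls"
proof -
  have le: "length ls \<le> length ks"
    if ks: "distinct (x # ks)" "\<forall>z\<in>set (x # ks). \<sigma> z = cycle_of_list (x # ks) z"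
      and ls: "distinct (x # ls)" "\<forall>z\<in>set (x # ls). \<sigma> z = cycle_of_list (x # ls) z"
    for ks ls
  proof (rule ccontr)
    assume "\<not> length ls \<le> length ks"
    then have "Suc (length ks) \<le> length ls" by simp
    then have "(x # ls) ! Suc (length ks) = (\<sigma> ^^ Suc (length ks)) x"
      by (rule nth_cycle_funpow(1)[OF ls])
    also have "\<dots> = x" by (rule nth_cycle_funpow(2)[OF ks])
    finally have "ls ! length ks = x" by simp
    moreover have "length ks < length ls" using \<open>\<not> length ls \<le> length ks\<close> by simp
    ultimately show False using ls(1) by (metis distinct.simps(2) nth_mem)
  qed
  have len: "length ks = length ls"
    by (intro antisym le assms)
  have "(x # ks) ! i = (x # ls) ! i" if "i < length (x # ks)" for i
    using nth_cycle_funpow(1)[OF assms(1,2), of i] nth_cycle_funpow(1)[OF assms(3,4), of i] that len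
    by simp
  then have "x # ks = x # ls" using len by (intro nth_equalityI) auto
  then show ?thesis by simp
qed

lemma cycles_perm_on_head:
  assumes "distinct (concat (c # cs))" "z \<in> set c"
  shows "cycles_perm (c # cs) z = cycle_of_list c z"
proof -
  have "z \<notin> set (concat cs)" using assms by auto
  then show ?thesis using permutes_not_in[OF cycles_perm_permutes] by (metis cycles_perm_simps(2) comp_apply)
qed

lemma inj_on_cycles_perm:
  assumes R: "strict_order R" and "finite S"
  shows "inj_on cycles_perm (canonical R S)"
  using assms(2)
proof (induction "card S" arbitrary: S rule: less_induct)
  case less
  show ?case
  proof (cases "S = {}")
    case False
    obtain x where x: "x \<in> S" "\<forall>y\<in>S - {x}. R x y"
      using least_element_exists[OF R less.prems False] by blast
    show ?thesis
    proof (rule inj_onI)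
      fix cs ds
      assume cs: "cs \<in> canonical R S" and ds: "ds \<in> canonical R S"
        and eq: "cycles_perm cs = cycles_perm ds"
      from cs obtain ks cs' where c: "cs = (x # ks) # cs'" "cs' \<in> canonical R (S - {x} - set ks)"
        unfolding canonical_step[OF R x] by blast
      from ds obtain ls ds' where d: "ds = (x # ls) # ds'" "ds' \<in> canonical R (S - {x} - set ls)"
        unfolding canonical_step[OF R x] by blast
      have dc: "distinct (concat ((x # ks) # cs'))" and dd: "distinct (concat ((x # ls) # ds'))"
        using cs ds unfolding canonical_def c d by auto
      have "ks = ls"
      proof (rule cycle_through_unique)
        show "\<forall>z\<in>set (x # ks). cycles_perm cs z = cycle_of_list (x # ks) z"
          unfolding c using cycles_perm_on_head[OF dc] by blast
        show "\<forall>z\<in>set (x # ls). cycles_perm cs z = cycle_of_list (x # ls) z"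
          unfolding eq d using cycles_perm_on_head[OF dd] by blast
      qed (use dc dd in auto)
      moreover have "inj (cycle_of_list (x # ks))"
        by (rule permutes_inj[OF cycle_permutes])
      then have "cycles_perm cs' = cycles_perm ds'"
        using eq unfolding c d \<open>ks = ls\<close> cycles_perm_simps by (metis fun.inj_map_strong injD comp_apply ext)
      moreover have "inj_on cycles_perm (canonical R (S - {x} - set ks))"
        by (intro less.hyps psubset_card_mono) (use x less.prems in auto)
      ultimately have "cs' = ds'" using c d by (metis inj_onD)
      then show "cs = ds" by (simp add: c d \<open>ks = ls\<close>)
    qed
  qed simp
qed

text \<open>
  Split off the orbit of the least element \<open>x\<close>: composing \<open>\<sigma>\<close> with the inverse of its cycle at \<open>x\<close>
  fixes that orbit, so the induction hypothesis applies to the rest.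
\<close>

lemma cycles_perm_surj:
  assumes R: "strict_order R" and "finite S" "\<sigma> permutes S"
  shows "\<exists>cs\<in>canonical R S. cycles_perm cs = \<sigma>"
  using assms(2,3)
proof (induction "card S" arbitrary: S \<sigma> rule: less_induct)
  case less
  show ?case
  proof (cases "S = {}")
    case True
    then show ?thesis using less.prems by simp
  next
    case False
    obtain x where x: "x \<in> S" "\<forall>y\<in>S - {x}. R x y"
      using least_element_exists[OF R less.prems(1) False] by blast
    have perm: "permutation \<sigma>" using less.prems by (auto simp: permutation_permutes)
    define c where "c = support \<sigma> x"
    have "least_power \<sigma> x > 0" by (rule least_power_of_permutation(2)[OF perm])
    then obtain ks where ks: "c = x # ks"
      unfolding c_def by (cases "[0..<least_power \<sigma> x]") (auto simp: upt_eq_Cons_conv)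
    have dist: "distinct c" unfolding c_def by (rule cycle_of_permutation[OF perm])
    have cS: "set c \<subseteq> S"
      using x(1) permutes_in_image[OF permutes_funpow[OF less.prems(2)]] by (auto simp: c_def)
    define q where "q = inv_into UNIV (cycle_of_list c) \<circ> \<sigma>"
    have cperm: "cycle_of_list c permutes S" by (rule permutes_subset[OF cycle_permutes cS])
    have "q permutes (S - set c)"
    proof (rule permutes_superset)
      show "q permutes S" unfolding q_def
        by (intro permutes_compose permutes_inv cperm less.prems)
      fix z assume "z \<in> S - (S - set c)"
      then have "\<sigma> z = cycle_of_list c z" using cycle_restrict[OF perm] by (auto simp: c_def)
      then show "q z = z" using permutes_inverses(2)[OF cperm] by (simp add: q_def)
    qed
    moreover have "S - set c = S - {x} - set ks" by (auto simp: ks)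
    moreover have "card (S - set c) < card S"
      by (intro psubset_card_mono) (use x less.prems in \<open>auto simp: ks\<close>)
    ultimately obtain cs where cs: "cs \<in> canonical R (S - {x} - set ks)" "cycles_perm cs = q"
      using less.hyps[of "S - set c" q] less.prems by auto
    have "(x # ks) # cs \<in> canonical R S"
      unfolding canonical_step[OF R x] using cs dist cS by (auto simp: ks arrangements_def)
    moreover have "cycles_perm ((x # ks) # cs) = \<sigma>"
      unfolding cycles_perm_simps cs(2) q_def ks[symmetric]
      using permutes_inverses(1)[OF cperm] by (auto simp: fun_eq_iff)
    ultimately show ?thesis by blast
  qed
qed

lemma bij_betw_cycles_perm:
  assumes "strict_order R" "finite S"
  shows "bij_betw cycles_perm (canonical R S) {\<sigma>. \<sigma> permutes S}"
  unfolding bij_betw_def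
proof
  show "cycles_perm ` canonical R S = {\<sigma>. \<sigma> permutes S}"
    using cycles_perm_surj[OF assms] cycles_perm_permutes by (fastforce simp: canonical_def)
qed (rule inj_on_cycles_perm[OF assms])

lemma chen_notation_iff:
  "chen_notation n \<sigma> cs \<longleftrightarrow> cs \<in> canonical (>) {..<n} \<and> \<sigma> = cycles_perm cs"
  by (auto simp: chen_notation_def cycle_notation_def canonical_def cycles_perm_def)

lemma moore_notation_iff:
  "moore_notation n \<sigma> cs \<longleftrightarrow> rev cs \<in> canonical (<) {..<n} \<and> \<sigma> = cycles_perm (rev cs)"
proof -
  have "sorted_wrt (<) (map hd (rev cs)) = sorted_wrt (>) (map hd cs)"
    by (simp add: rev_map[symmetric] sorted_wrt_rev)
  then show ?thesis
    using cycles_perm_rev[of cs]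
    by (auto simp: moore_notation_def cycle_notation_def canonical_def cycles_perm_def)
qed

text \<open>
  Existence and uniqueness of canonical notations turn a sum over permutations, each with its
  definite notation, into a sum over the notations themselves.
\<close>

lemma sum_permutations_canonical:
  assumes "strict_order R" "finite S"
  shows "(\<Sum>\<sigma> | \<sigma> permutes S. F \<sigma> (THE cs. cs \<in> canonical R S \<and> \<sigma> = cycles_perm cs)) =
    (\<Sum>cs\<in>canonical R S. F (cycles_perm cs) cs)"
proof -
  have "(THE ds. ds \<in> canonical R S \<and> cycles_perm cs = cycles_perm ds) = cs"
    if "cs \<in> canonical R S" for cs
    using that inj_onD[OF inj_on_cycles_perm[OF assms]] by (intro the_equality) auto
  then show ?thesis
    by (subst sum.reindex_bij_betw[OF bij_betw_cycles_perm[OF assms], symmetric]) simp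
qed

section \<open>The determinants of Moore and Chen\<close>

lemma neg_one_power_commute: "(- 1 :: 'a::ring_1) ^ n * x = x * (- 1) ^ n"
  by (cases "even n") simp_all

lemma neg_one_power_left_commute: "(- 1 :: 'a::ring_1) ^ n * (x * y) = x * ((- 1) ^ n * y)"
  by (metis mult.assoc neg_one_power_commute)

lemma perm_term_Cons: "perm_term A (c # cs) = cycle_term A c * perm_term A cs"
  and perm_term_rev_Cons: "perm_term A (rev (c # cs)) = perm_term A (rev cs) * cycle_term A c"
  by (simp_all add: perm_term_def)

lemma signed_length_Cons:
  "(- 1 :: 'a::ring_1) ^ (length (concat ((x # ks) # cs)) + length ((x # ks) # cs)) =
    (- 1) ^ length ks * (- 1) ^ (length (concat cs) + length cs)"
  by (simp add: power_add mult.assoc)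

lemma path_weight_eq_prod:
  "path_weight a x ks y = (- 1) ^ length ks * prod_list (map2 a (x # ks) (ks @ [y]))"
proof (induction ks arbitrary: x)
  case (Cons k ks)
  then show ?case
    using neg_one_power_commute[of "length ks" "a x k"] by (simp flip: mult.assoc)
qed simp

lemma path_weight_eq_cycle_term:
  "path_weight (\<lambda>i j. A $$ (i, j)) x ks x = (- 1) ^ length ks * cycle_term A (x # ks)"
  using path_weight_eq_prod[of "\<lambda>i j. A $$ (i, j)" x ks x] by (simp add: cycle_term_def)

text \<open>
  The two alternatives for \<open>G\<close> cover both determinants: Chen's product has the first canonical cycle as
  its leftmost factor, Moore's product, which runs through the cycles backwards, as its rightmost. The
  inner sums are determinants of smaller sets, hence central, and the alternatives agree.
\<close>

lemma sum_canonical_eq_cycle_det: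
  fixes G :: "nat list list \<Rightarrow> dual_quat"
  assumes R: "strict_order R" and fin: "finite S" and herm: "hermitian_on S a"
    and Nil: "G [] = 1"
    and Cons: "(\<forall>x ks cs. G ((x # ks) # cs) = path_weight a x ks x * G cs) \<or>
      (\<forall>x ks cs. G ((x # ks) # cs) = G cs * path_weight a x ks x)"
  shows "(\<Sum>cs\<in>canonical R S. G cs) = cycle_det a S"
  using fin herm
proof (induction "card S" arbitrary: S rule: less_induct)
  case less
  show ?case
  proof (cases "S = {}")
    case False
    obtain x where x: "x \<in> S" "\<forall>y\<in>S - {x}. R x y"
      using least_element_exists[OF R less.prems(1) False] by blast
    have IH: "(\<Sum>cs\<in>canonical R (S - {x} - set ks). G cs) = cycle_det a (S - {x} - set ks)" for ks
      using x less.prems by (intro less.hyps psubset_card_mono) (auto intro: hermitian_on_subset)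
    have "(\<Sum>cs\<in>canonical R (S - {x} - set ks). G ((x # ks) # cs)) =
        path_weight a x ks x * cycle_det a (S - {x} - set ks)" for ks
      using Cons
    proof
      assume "\<forall>x ks cs. G ((x # ks) # cs) = path_weight a x ks x * G cs"
      then show ?thesis by (simp add: IH flip: sum_distrib_left)
    next
      assume "\<forall>x ks cs. G ((x # ks) # cs) = G cs * path_weight a x ks x"
      then show ?thesis by (simp add: IH flip: sum_distrib_right cycle_det_commute)
    qed
    then have "(\<Sum>cs\<in>canonical R S. G cs) =
        (\<Sum>ks\<in>arrangements (S - {x}). path_weight a x ks x * cycle_det a (S - {x} - set ks))"
      by (subst sum_canonical_step[OF R less.prems(1) x]) simp
    also have "\<dots> = cycle_det a (insert x (S - {x}))"
      using less.prems x by (subst cycle_det_expand_hermitian) (auto simp: insert_absorb)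
    finally show ?thesis using x by (simp add: insert_absorb)
  qed (simp add: Nil)
qed

lemma dq_hermitian_on:
  assumes "A \<in> carrier_mat n n" "dq_hermitian A"
  shows "hermitian_on {..<n} (\<lambda>i j. A $$ (i, j))"
proof -
  have "dq_cnj (A $$ (i, j)) = dq_adjoint A $$ (j, i)" if "i < n" "j < n" for i j
    using that assms(1) by (simp add: dq_adjoint_def)
  then show ?thesis using assms(2) by (simp add: hermitian_on_def dq_hermitian_def)
qed

text \<open>
  With \<open>r\<close> cycles on \<open>n\<close> indices the sign is \<open>(-1)\<^bsup>n - r\<^esup> = (-1)\<^bsup>n + r\<^esup>\<close>; the second form has no
  truncated subtraction and splits multiplicatively along the list of cycles.
\<close>

theorem Cdet_eq_cycle_det:
  assumes A: "A \<in> carrier_mat n n" "dq_hermitian A"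
  shows "Cdet A = cycle_det (\<lambda>i j. A $$ (i, j)) {..<n}"
proof -
  let ?G = "\<lambda>cs. (- 1) ^ (length (concat cs) + length cs) * perm_term A cs"
  have "Cdet A = (\<Sum>cs\<in>canonical (>) {..<n}. (- 1) ^ (n - length cs) * perm_term A cs)"
    using A(1) sum_permutations_canonical[OF strict_order_greater, of "{..<n}"
        "\<lambda>_ cs. (- 1) ^ (n - length cs) * perm_term A cs"]
    by (simp add: Cdet_def chen_notation_iff Let_def)
  also have "\<dots> = (\<Sum>cs\<in>canonical (>) {..<n}. ?G cs)"
  proof (intro sum.cong refl)
    fix cs assume cs: "cs \<in> canonical (>) {..<n}"
    have n: "length (concat cs) = n"
      using cs distinct_card[of "concat cs"] by (simp add: canonical_def)
    have "length cs \<le> length (concat cs)" if "[] \<notin> set cs" for cs :: "nat list list"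
      using that
    proof (induction cs)
      case (Cons c cs)
      then show ?case by (cases c) auto
    qed simp
    then have "length cs \<le> n" using cs n by (metis (no_types, lifting) canonical_def mem_Collect_eq)
    then show "(- 1) ^ (n - length cs) * perm_term A cs = ?G cs"
      by (simp only: n neg_one_power_add_eq_neg_one_power_diff)
  qed
  also have "\<dots> = cycle_det (\<lambda>i j. A $$ (i, j)) {..<n}"
  proof (rule sum_canonical_eq_cycle_det[OF strict_order_greater])
    have "?G ((x # ks) # cs) = path_weight (\<lambda>i j. A $$ (i, j)) x ks x * ?G cs" for x ks cs
      unfolding path_weight_eq_cycle_term signed_length_Cons
      by (simp only: perm_term_Cons mult.assoc neg_one_power_left_commute[of _ "cycle_term A (x # ks)"])
    then show "(\<forall>x ks cs. ?G ((x # ks) # cs) = path_weight (\<lambda>i j. A $$ (i, j)) x ks x * ?G cs) \<or>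
      (\<forall>x ks cs. ?G ((x # ks) # cs) = ?G cs * path_weight (\<lambda>i j. A $$ (i, j)) x ks x)" by blast
  qed (use dq_hermitian_on[OF A] in \<open>simp_all add: perm_term_def\<close>)
  finally show ?thesis .
qed

theorem Mdet_eq_cycle_det:
  assumes A: "A \<in> carrier_mat n n" "dq_hermitian A"
  shows "Mdet A = cycle_det (\<lambda>i j. A $$ (i, j)) {..<n}"
proof -
  let ?G = "\<lambda>cs. (- 1) ^ (length (concat cs) + length cs) * perm_term A (rev cs)"
  have the: "(THE cs. moore_notation n \<sigma> cs) = rev (THE cs. cs \<in> canonical (<) {..<n} \<and> \<sigma> = cycles_perm cs)"
    if perm: "\<sigma> permutes {..<n}" for \<sigma>
  proof -
    obtain cs where cs: "cs \<in> canonical (<) {..<n}" "cycles_perm cs = \<sigma>"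
      using cycles_perm_surj[OF strict_order_less finite_lessThan perm] by auto
    have uniq: "ds = cs" if "ds \<in> canonical (<) {..<n}" "\<sigma> = cycles_perm ds" for ds
      using inj_onD[OF inj_on_cycles_perm[OF strict_order_less, of "{..<n}"]] that cs by auto
    have "(THE cs. cs \<in> canonical (<) {..<n} \<and> \<sigma> = cycles_perm cs) = cs"
      by (rule the_equality) (use cs uniq in blast)+
    moreover have "(THE cs. moore_notation n \<sigma> cs) = rev cs"
      unfolding moore_notation_iff
    proof (rule the_equality)
      fix ds assume "rev ds \<in> canonical (<) {..<n} \<and> \<sigma> = cycles_perm (rev ds)"
      then have "rev ds = cs" using uniq by blast
      then show "ds = rev cs" by auto
    qed (use cs in simp)
    ultimately show ?thesis by simp
  qed
  have "Mdet A = (\<Sum>\<sigma> | \<sigma> permutes {..<n}. of_int (sign \<sigma>) *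
      perm_term A (rev (THE cs. cs \<in> canonical (<) {..<n} \<and> \<sigma> = cycles_perm cs)))"
    using A(1) by (simp add: Mdet_def the)
  also have "\<dots> = (\<Sum>cs\<in>canonical (<) {..<n}. of_int (sign (cycles_perm cs)) * perm_term A (rev cs))"
    by (rule sum_permutations_canonical[OF strict_order_less]) simp
  also have "\<dots> = (\<Sum>cs\<in>canonical (<) {..<n}. ?G cs)"
    by (intro sum.cong refl) (simp add: canonical_def sign_cycles_perm)
  also have "\<dots> = cycle_det (\<lambda>i j. A $$ (i, j)) {..<n}"
  proof (rule sum_canonical_eq_cycle_det[OF strict_order_less])
    have "?G ((x # ks) # cs) = ?G cs * path_weight (\<lambda>i j. A $$ (i, j)) x ks x" for x ks cs
      unfolding path_weight_eq_cycle_term signed_length_Cons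
      by (simp only: perm_term_rev_Cons mult.assoc neg_one_power_left_commute[of "length ks"])
    then show "(\<forall>x ks cs. ?G ((x # ks) # cs) = path_weight (\<lambda>i j. A $$ (i, j)) x ks x * ?G cs) \<or>
      (\<forall>x ks cs. ?G ((x # ks) # cs) = ?G cs * path_weight (\<lambda>i j. A $$ (i, j)) x ks x)" by blast
  qed (use dq_hermitian_on[OF A] in \<open>simp_all add: perm_term_def\<close>)
  finally show ?thesis .
qed

section \<open>Scaling columns by dual numbers\<close>

lemma prod_list_real_perm:
  fixes us vs :: "dual_quat list"
  assumes "mset us = mset vs" "\<forall>u\<in>set us. dq_cnj u = u"
  shows "prod_list us = prod_list vs"
  using assms
proof (induction us arbitrary: vs)
  case (Cons u us)
  then have "u \<in> set vs" by (metis list.set_intros(1) mset_eq_setD)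
  then obtain ps qs where vs: "vs = ps @ u # qs" by (meson split_list)
  have "prod_list us = prod_list (ps @ qs)"
    using Cons.prems by (intro Cons.IH) (auto simp: vs)
  moreover have "u * prod_list ps = prod_list ps * u"
    using Cons.prems by (intro dq_real_commute) simp
  ultimately show ?case by (simp add: vs flip: mult.assoc)
qed simp

lemma cnj_prod_list_real:
  "\<forall>u\<in>set us. dq_cnj u = u \<Longrightarrow> dq_cnj (prod_list us) = prod_list us"
  by (induction us) (simp_all add: dq_cnj_mult_real)

lemma path_weight_scale_columns:
  fixes g :: "nat \<Rightarrow> nat \<Rightarrow> dual_quat"
  assumes l: "\<forall>k\<in>set ks. dq_cnj (l k) = l k"
  shows "path_weight (\<lambda>i j. g i j * l j) x ks y = path_weight g x ks y * (prod_list (map l ks) * l y)"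
  using l
proof (induction ks arbitrary: x)
  case (Cons k ks)
  have "l k * z = z * l k" for z
    using Cons.prems by (intro dq_real_commute) simp
  then have "g x k * l k * (path_weight g k ks y * (prod_list (map l ks) * l y)) =
      g x k * path_weight g k ks y * (l k * (prod_list (map l ks) * l y))"
    by (metis mult.assoc)
  then show ?case using Cons by (simp add: mult.assoc)
qed simp

text \<open>
  Each cycle term is multiplied by the central factors \<open>l k\<close> of its elements, and the cycles of a
  permutation exhaust \<open>S\<close>. The list \<open>zs\<close> enumerates \<open>S\<close>; its order does not affect the product.
\<close>

lemma cycle_det_scale_columns:
  assumes "\<forall>k\<in>S. dq_cnj (l k) = l k" "distinct zs" "set zs = S"
  shows "cycle_det (\<lambda>i j. g i j * l j) S = cycle_det g S * prod_list (map l zs)"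
  using assms
proof (induction g S arbitrary: zs rule: cycle_det.induct)
  case (1 g S)
  show ?case
  proof (cases "S = {}")
    case False
    have fin: "finite S" using 1(4) by auto
    let ?x = "Min S" and ?h = "\<lambda>i j. g i j * l j"
    have x: "?x \<in> S" using fin False by simp
    have "dq_re (path_weight ?h ?x ks ?x) * cycle_det ?h (S - {?x} - set ks) =
        dq_re (path_weight g ?x ks ?x) * cycle_det g (S - {?x} - set ks) * prod_list (map l zs)"
      if ks: "ks \<in> arrangements (S - {?x})" for ks
    proof -
      have sub: "distinct ks" "set ks \<subseteq> S - {?x}" using ks by (auto simp: arrangements_def)
      obtain rs where rs: "distinct rs" "set rs = S - {?x} - set ks"
        using fin finite_distinct_list by (metis finite_Diff)
      have IH: "cycle_det ?h (S - {?x} - set ks) = cycle_det g (S - {?x} - set ks) * prod_list (map l rs)"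
        using 1(2) fin False rs by (intro 1(1) ks) auto
      let ?L = "prod_list (map l ks) * l ?x"
      have L: "dq_cnj ?L = ?L"
        using sub x 1(2) by (intro dq_cnj_mult_real cnj_prod_list_real) auto
      have "mset (ks @ ?x # rs) = mset zs"
        using sub rs x 1(3,4) by (intro set_eq_iff_mset_eq_distinct[THEN iffD1]) auto
      then have "mset (map l (ks @ ?x # rs)) = mset (map l zs)" by (simp only: mset_map)
      then have "prod_list (map l (ks @ ?x # rs)) = prod_list (map l zs)"
        using sub rs x 1(2) by (intro prod_list_real_perm) auto
      then have prod: "?L * prod_list (map l rs) = prod_list (map l zs)" by (simp add: mult.assoc)
      have "dq_re (path_weight ?h ?x ks ?x) = dq_re (path_weight g ?x ks ?x) * ?L"
        using sub 1(2) L by (subst path_weight_scale_columns) (auto simp: dq_re_mult_real)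
      then have "dq_re (path_weight ?h ?x ks ?x) * cycle_det ?h (S - {?x} - set ks) =
          dq_re (path_weight g ?x ks ?x) * (?L * cycle_det g (S - {?x} - set ks)) * prod_list (map l rs)"
        by (simp add: IH mult.assoc)
      also have "?L * cycle_det g (S - {?x} - set ks) = cycle_det g (S - {?x} - set ks) * ?L"
        by (rule cycle_det_commute[symmetric])
      finally show ?thesis by (simp only: mult.assoc prod[unfolded mult.assoc])
    qed
    then show ?thesis
      using fin False by (simp add: cycle_det_Min sum_distrib_right)
  qed (use 1 in simp)
qed

lemma cycle_det_identity:
  assumes "finite S" shows "cycle_det (\<lambda>i j. if i = j then 1 else 0) S = 1"
  using assms
proof (induction S rule: finite_induct)
  case (insert x S)
  let ?e = "\<lambda>i j :: nat. if i = j then 1 else (0 :: dual_quat)"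
  have "path_weight ?e x ks x = (if ks = [] then 1 else 0)" if "ks \<in> arrangements S" for ks
    using that insert.hyps by (cases ks) (auto simp: arrangements_def)
  then have "cycle_det ?e (insert x S) = (\<Sum>ks\<in>arrangements S. if ks = [] then cycle_det ?e (S - set ks) else 0)"
    using insert.hyps by (subst cycle_det_expand) (auto intro!: sum.cong)
  then show ?case
    using insert finite_arrangements[of S] by (simp add: sum.delta)
qed simp

section \<open>Hermitian matrices under change of basis\<close>

lemma std_sum: "std (sum f S) = (\<Sum>i\<in>S. std (f i))"
  by (induction S rule: infinite_finite_induct) auto

lemma quat_right_left_inverse:
  assumes "q \<noteq> 0" obtains r :: quat where "q * r = 1" "r * q = 1"
proof -
  define N where "N = (Re_q q)\<^sup>2 + (Im_i q)\<^sup>2 + (Im_j q)\<^sup>2 + (Im_k q)\<^sup>2"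
  have N: "N \<noteq> 0"
    using assms by (auto simp: N_def quat_eq_iff add_nonneg_eq_0_iff)
  define r where "r = Quat (Re_q q / N) (- Im_i q / N) (- Im_j q / N) (- Im_k q / N)"
  have "q * r = 1" "r * q = 1"
    using N by (simp_all add: r_def quat_eq_iff N_def power2_eq_square flip: add_divide_distrib diff_divide_distrib)
  then show thesis by (rule that)
qed

text \<open>
  Dual quaternions form a local ring: if \<open>s\<close> inverts the standard part of \<open>q = q\<^sub>s + q\<^sub>d \<epsilon>\<close>, then
  \<open>s - s q\<^sub>d s \<epsilon>\<close> inverts \<open>q\<close>.
\<close>

lemma dual_quat_right_left_inverse:
  fixes q :: dual_quat
  assumes "std q \<noteq> 0" obtains r where "q * r = 1" "r * q = 1"
proof -
  obtain s where s: "std q * s = 1" "s * std q = 1"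
    using quat_right_left_inverse[OF assms] .
  define r where "r = Dual s (- (s * inft q * s))"
  have "q * r = 1" "r * q = 1"
    using s by (auto simp: r_def dual_eq_iff mult.assoc) (simp flip: mult.assoc)+
  then show thesis by (rule that)
qed

lemma dq_adjoint_carrier [simp]: "A \<in> carrier_mat n m \<Longrightarrow> dq_adjoint A \<in> carrier_mat m n"
  by (auto simp: dq_adjoint_def)

lemma dq_adjoint_index:
  "A \<in> carrier_mat n m \<Longrightarrow> i < m \<Longrightarrow> j < n \<Longrightarrow> dq_adjoint A $$ (i, j) = dq_cnj (A $$ (j, i))"
  by (auto simp: dq_adjoint_def)

lemma index_mult_sum:
  "A \<in> carrier_mat n m \<Longrightarrow> B \<in> carrier_mat m k \<Longrightarrow> i < n \<Longrightarrow> j < k \<Longrightarrow>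
    (A * B) $$ (i, j) = (\<Sum>l<m. A $$ (i, l) * B $$ (l, j))"
  by (auto simp: scalar_prod_def lessThan_atLeast0)

lemma index_mult_vec_sum:
  "A \<in> carrier_mat n m \<Longrightarrow> x \<in> carrier_vec m \<Longrightarrow> i < n \<Longrightarrow>
    (A *\<^sub>v x) $ i = (\<Sum>l<m. A $$ (i, l) * x $ l)"
  by (auto simp: scalar_prod_def lessThan_atLeast0)

lemma dq_adjoint_mult:
  assumes "A \<in> carrier_mat n m" "B \<in> carrier_mat m k"
  shows "dq_adjoint (A * B) = dq_adjoint B * dq_adjoint A"
proof (rule eq_matI)
  fix i j assume "i < dim_row (dq_adjoint B * dq_adjoint A)" "j < dim_col (dq_adjoint B * dq_adjoint A)"
  then have ij: "i < k" "j < n" using assms by (auto simp: dq_adjoint_def)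
  show "dq_adjoint (A * B) $$ (i, j) = (dq_adjoint B * dq_adjoint A) $$ (i, j)"
    using assms ij
    by (simp add: dq_adjoint_index[of _ n k] index_mult_sum[of _ n m _ k]
        index_mult_sum[of "dq_adjoint B" k m "dq_adjoint A" n] dq_adjoint_index[of A n m]
        dq_adjoint_index[of B m k] dq_cnj_sum dq_cnj_mult del: index_mult_mat)
qed (use assms in \<open>auto simp: dq_adjoint_def\<close>)

lemma dq_adjoint_adjoint: "dq_adjoint (dq_adjoint A) = A"
  by (rule eq_matI) (auto simp: dq_adjoint_def)

lemma dq_hermitian_congruence:
  assumes A: "A \<in> carrier_mat n n" "dq_hermitian A" and X: "X \<in> carrier_mat n m"
  shows "dq_hermitian (dq_adjoint X * A * X)"
proof -
  have X': "dq_adjoint X \<in> carrier_mat m n" using X by simp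
  have "dq_adjoint (dq_adjoint X * A * X) = dq_adjoint X * (dq_adjoint A * dq_adjoint (dq_adjoint X))"
    using A X X' by (simp add: dq_adjoint_mult[OF mult_carrier_mat[OF X' A(1)] X] dq_adjoint_mult[OF X' A(1)])
  also have "\<dots> = dq_adjoint X * A * X"
    using A by (simp add: dq_adjoint_adjoint dq_hermitian_def assoc_mult_mat[OF X' A(1) X])
  finally show ?thesis by (simp add: dq_hermitian_def)
qed

lemma dq_hermitian_one: "dq_hermitian (1\<^sub>m n)"
  by (auto simp: dq_hermitian_def dq_adjoint_def intro!: eq_matI)

text \<open>
  The identity matrix with column \<open>j\<close> replaced by \<open>y\<close>; as a change of basis it exchanges \<open>e\<^sub>j\<close> for \<open>y\<close>.
\<close>

definition exchange_mat :: "nat \<Rightarrow> nat \<Rightarrow> 'a::ring_1 vec \<Rightarrow> 'a mat" where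
  "exchange_mat n j y = mat n n (\<lambda>(i, k). if k = j then y $ i else if i = k then 1 else 0)"

lemma exchange_mat_carrier [simp]: "exchange_mat n j y \<in> carrier_mat n n"
  by (simp add: exchange_mat_def)

lemma exchange_mat_dim [simp]:
  "dim_row (exchange_mat n j y) = n" "dim_col (exchange_mat n j y) = n"
  by (simp_all add: exchange_mat_def)

lemma exchange_mat_index:
  "i < n \<Longrightarrow> k < n \<Longrightarrow>
    exchange_mat n j y $$ (i, k) = (if k = j then y $ i else if i = k then 1 else 0)"
  by (simp add: exchange_mat_def)

lemma mult_exchange_mat:
  assumes X: "X \<in> carrier_mat m n" and y: "y \<in> carrier_vec n" and "i < m" "k < n"
  shows "(X * exchange_mat n j y) $$ (i, k) = (if k = j then (X *\<^sub>v y) $ i else X $$ (i, k))"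
proof -
  have "(X * exchange_mat n j y) $$ (i, k) = (\<Sum>l<n. X $$ (i, l) * exchange_mat n j y $$ (l, k))"
    by (rule index_mult_sum[OF X exchange_mat_carrier assms(3,4)])
  also have "\<dots> = (if k = j then (X *\<^sub>v y) $ i else X $$ (i, k))"
  proof (cases "k = j")
    case True
    then show ?thesis
      using assms by (simp add: index_mult_vec_sum[OF X y] exchange_mat_def del: index_mult_mat_vec)
  next
    case False
    then have "(\<Sum>l<n. X $$ (i, l) * exchange_mat n j y $$ (l, k)) = (\<Sum>l<n. if l = k then X $$ (i, l) else 0)"
      using assms(4) by (intro sum.cong) (auto simp: exchange_mat_def)
    then show ?thesis using False assms(4) by simp
  qed
  finally show ?thesis .
qed

text \<open>
  If \<open>r\<close> inverts \<open>y\<^sub>j\<close>, then \<open>e\<^sub>j\<close> is \<open>y r\<close> minus the sum of the \<open>e\<^sub>i y\<^sub>i r\<close> with \<open>i \<noteq> j\<close>, so the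
  inverse has the same shape.
\<close>

lemma exchange_mat_inverse:
  fixes y :: "dual_quat vec"
  assumes "j < n" "y \<in> carrier_vec n" "std (y $ j) \<noteq> 0"
  obtains Q where "Q \<in> carrier_mat n n" "exchange_mat n j y * Q = 1\<^sub>m n"
proof -
  obtain r where r: "y $ j * r = 1" "r * y $ j = 1"
    using dual_quat_right_left_inverse[OF assms(3)] .
  define z where "z = vec n (\<lambda>i. if i = j then r else - (y $ i * r))"
  have z: "z \<in> carrier_vec n" by (simp add: z_def)
  have "(exchange_mat n j y *\<^sub>v z) $ i = (if i = j then 1 else 0)" if "i < n" for i
  proof -
    have "(exchange_mat n j y *\<^sub>v z) $ i =
        (\<Sum>l<n. (if l = j then y $ i * r else 0) + (if l = i then if i \<noteq> j then - (y $ i * r) else 0 else 0))"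
      unfolding index_mult_vec_sum[OF exchange_mat_carrier z that]
      using that by (intro sum.cong) (auto simp: exchange_mat_def z_def)
    also have "\<dots> = y $ i * r + (if i \<noteq> j then - (y $ i * r) else 0)"
      using that assms(1) by (simp add: sum.distrib)
    also have "\<dots> = (if i = j then 1 else 0)" using r by simp
    finally show ?thesis .
  qed
  then have "exchange_mat n j y * exchange_mat n j z = 1\<^sub>m n"
    using z assms by (intro eq_matI)
      (auto simp: mult_exchange_mat[of _ n n] exchange_mat_index simp del: index_mult_mat(1) index_mult_mat_vec)
  then show thesis by (rule that[rotated]) simp
qed

lemma cycle_det_exchange:
  assumes A: "A \<in> carrier_mat n n" "dq_hermitian A" and y: "y \<in> carrier_vec n" and j: "j < n"
  defines "P \<equiv> exchange_mat n j y"
  shows "cycle_det (\<lambda>i k. (dq_adjoint P * A * P) $$ (i, k)) {..<n} =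
    dq_cnj (y $ j) * y $ j * cycle_det (\<lambda>i k. A $$ (i, k)) {..<n}"
proof -
  have P: "P \<in> carrier_mat n n" by (simp add: P_def)
  have AP: "(A * P) $$ (i, k) = (if k = j then (A *\<^sub>v y) $ i else A $$ (i, k))"
    if "i < n" "k < n" for i k
    unfolding P_def by (rule mult_exchange_mat[OF A(1) y that])
  have PAP: "(dq_adjoint P * A * P) $$ (i, k) =
      (if i = j then (\<Sum>l<n. dq_cnj (y $ l) * (A * P) $$ (l, k)) else (A * P) $$ (i, k))"
    if "i < n" "k < n" for i k
  proof -
    have "(dq_adjoint P * A * P) $$ (i, k) = (dq_adjoint P * (A * P)) $$ (i, k)"
      using A P by (subst assoc_mult_mat[of _ n n _ n _ n]) auto
    also have "\<dots> = (\<Sum>l<n. dq_adjoint P $$ (i, l) * (A * P) $$ (l, k))"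
      using A P that by (intro index_mult_sum) auto
    also have "\<dots> = (\<Sum>l<n. dq_cnj (P $$ (l, i)) * (A * P) $$ (l, k))"
      using that P by (intro sum.cong) (auto simp: dq_adjoint_index)
    also have "\<dots> = (if i = j then (\<Sum>l<n. dq_cnj (y $ l) * (A * P) $$ (l, k)) else (A * P) $$ (i, k))"
    proof (cases "i = j")
      case True
      then show ?thesis using that by (simp add: P_def exchange_mat_index del: index_mult_mat)
    next
      case False
      then have "(\<Sum>l<n. dq_cnj (P $$ (l, i)) * (A * P) $$ (l, k)) =
          (\<Sum>l<n. if l = i then (A * P) $$ (l, k) else 0)"
        using that by (intro sum.cong) (auto simp: P_def exchange_mat_index)
      then show ?thesis using False that by (simp del: index_mult_mat)
    qed
    finally show ?thesis .
  qed
  have "dq_hermitian (dq_adjoint P * A * P)"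
    by (rule dq_hermitian_congruence[OF A P])
  then have herm: "hermitian_on {..<n} (\<lambda>i k. (dq_adjoint P * A * P) $$ (i, k))"
    using A P by (intro dq_hermitian_on mult_carrier_mat[of _ n n] dq_adjoint_carrier)
  show ?thesis
    by (rule cycle_det_base_change[where v = "\<lambda>k. (A *\<^sub>v y) $ k"])
      (use j A y herm in \<open>auto simp: PAP AP index_mult_vec_sum dq_hermitian_on intro!: sum.cong
        simp del: index_mult_mat index_mult_mat_vec\<close>)
qed

section \<open>Steinitz exchange\<close>

text \<open>
  After \<open>k\<close> exchanges the columns of \<open>X\<close> with index in \<open>J\<close> are the first \<open>k\<close> given vectors, in the
  order prescribed by \<open>\<pi>\<close>, while the other columns are still standard basis vectors. For the next
  vector \<open>x\<close> write \<open>x = X y\<close> with \<open>y = Y x\<close>. Some coordinate \<open>y\<^sub>j\<close> with \<open>j \<notin> J\<close> has nonzero standard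
  part, since otherwise the standard part of \<open>x\<close> would depend on those of its predecessors; then \<open>y\<^sub>j\<close> is
  invertible and column \<open>j\<close> can be exchanged. Each exchange changes determinants of Hermitian forms
  by the factor \<open>y\<^sub>j\<^sup>* y\<^sub>j\<close>, and \<open>N\<close> collects these factors.
\<close>

lemma exists_congruence_with_columns:
  fixes xs :: "dual_quat vec list"
  assumes xs: "\<forall>x\<in>set xs. x \<in> carrier_vec n"
    and indep: "right_independent n (map (map_vec std) xs)"
  shows "k \<le> length xs \<Longrightarrow> \<exists>X Y J \<pi> N N'. X \<in> carrier_mat n n \<and> Y \<in> carrier_mat n n \<and> X * Y = 1\<^sub>m n \<and>
    J \<subseteq> {..<n} \<and> bij_betw \<pi> J {..<k} \<and> (\<forall>j\<in>J. \<forall>i<n. X $$ (i, j) = xs ! \<pi> j $ i) \<and>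
    N' * N = (1 :: dual_quat) \<and>
    (\<forall>A. A \<in> carrier_mat n n \<longrightarrow> dq_hermitian A \<longrightarrow>
      cycle_det (\<lambda>i j. (dq_adjoint X * A * X) $$ (i, j)) {..<n} = N * cycle_det (\<lambda>i j. A $$ (i, j)) {..<n})"
proof (induction k)
  case 0
  have "dq_adjoint (1\<^sub>m n) = (1\<^sub>m n :: dual_quat mat)"
    using dq_hermitian_one by (simp add: dq_hermitian_def)
  then show ?case
    by (intro exI[of _ "1\<^sub>m n"] exI[of _ "{}"] exI[of _ "\<lambda>_. 0"] exI[of _ 1])
      (auto simp: bij_betw_def)
next
  case (Suc k)
  then obtain X Y J \<pi> N N' where X: "X \<in> carrier_mat n n" and Y: "Y \<in> carrier_mat n n"
    and XY: "X * Y = 1\<^sub>m n" and J: "J \<subseteq> {..<n}" and \<pi>: "bij_betw \<pi> J {..<k}"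
    and cols: "\<forall>j\<in>J. \<forall>i<n. X $$ (i, j) = xs ! \<pi> j $ i" and N: "N' * N = (1 :: dual_quat)"
    and det: "\<And>A. A \<in> carrier_mat n n \<Longrightarrow> dq_hermitian A \<Longrightarrow>
      cycle_det (\<lambda>i j. (dq_adjoint X * A * X) $$ (i, j)) {..<n} = N * cycle_det (\<lambda>i j. A $$ (i, j)) {..<n}"
    by auto
  have k: "k < length xs" using Suc.prems by simp
  define x where "x = xs ! k"
  have x: "x \<in> carrier_vec n" using xs k by (simp add: x_def)
  define y where "y = Y *\<^sub>v x"
  have y: "y \<in> carrier_vec n" using Y x by (simp add: y_def)
  have Xy: "X *\<^sub>v y = x"
    unfolding y_def using X Y x by (simp add: XY flip: assoc_mult_mat_vec)
  have "\<exists>j\<in>{..<n} - J. std (y $ j) \<noteq> 0"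
  proof (rule ccontr)
    assume "\<not> ?thesis"
    then have zero: "std (y $ j) = 0" if "j < n" "j \<notin> J" for j using that by auto
    \<comment> \<open>The relation \<open>x = \<Sum>\<^sub>j X\<^sub>j y\<^sub>j\<close> in standard parts; the coefficient of \<open>x\<close> itself is \<open>- 1\<close>.\<close>
    define c where "c m = (if m < k then std (y $ inv_into J \<pi> m) else if m = k then - 1 else 0)" for m
    have "(\<Sum>m<length xs. std (xs ! m $ i) * c m) = 0" if i: "i < n" for i
    proof -
      have "std (x $ i) = (\<Sum>j<n. std (X $$ (i, j)) * std (y $ j))"
        using index_mult_vec_sum[OF X y i] by (simp add: Xy std_sum)
      also have "\<dots> = (\<Sum>j\<in>J. std (X $$ (i, j)) * std (y $ j))"
        using J zero by (intro sum.mono_neutral_right) auto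
      also have "\<dots> = (\<Sum>j\<in>J. std (xs ! \<pi> j $ i) * c (\<pi> j))"
      proof (rule sum.cong[OF refl])
        fix j assume "j \<in> J"
        then have "\<pi> j < k" "inv_into J \<pi> (\<pi> j) = j"
          using \<pi> bij_betw_inv_into_left[OF \<pi>] by (auto dest: bij_betwE)
        then show "std (X $$ (i, j)) * std (y $ j) = std (xs ! \<pi> j $ i) * c (\<pi> j)"
          using cols \<open>j \<in> J\<close> i by (simp add: c_def)
      qed
      also have "\<dots> = (\<Sum>m<k. std (xs ! m $ i) * c m)"
        by (rule sum.reindex_bij_betw[OF \<pi>])
      finally have "(\<Sum>m<Suc k. std (xs ! m $ i) * c m) = 0"
        by (simp add: c_def x_def)
      moreover have "(\<Sum>m<length xs. std (xs ! m $ i) * c m) = (\<Sum>m<Suc k. std (xs ! m $ i) * c m)"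
        using k by (intro sum.mono_neutral_right) (auto simp: c_def)
      ultimately show ?thesis by simp
    qed
    moreover have "(\<Sum>m<length (map (map_vec std) xs). (map (map_vec std) xs ! m) $ i * c m) =
        (\<Sum>m<length xs. std (xs ! m $ i) * c m)" if "i < n" for i
    proof (rule sum.cong)
      fix m assume "m \<in> {..<length xs}"
      then have "xs ! m \<in> carrier_vec n" using xs by simp
      then show "(map (map_vec std) xs ! m) $ i * c m = std (xs ! m $ i) * c m"
        using \<open>m \<in> {..<length xs}\<close> that by simp
    qed simp
    ultimately have "c k = 0"
      using indep k unfolding right_independent_def by simp
    then show False by (simp add: c_def)
  qed
  then obtain j where j: "j < n" "j \<notin> J" "std (y $ j) \<noteq> 0" by auto
  define P where "P = exchange_mat n j y"
  have P: "P \<in> carrier_mat n n" by (simp add: P_def)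
  obtain Q where Q: "Q \<in> carrier_mat n n" "P * Q = 1\<^sub>m n"
    using exchange_mat_inverse[OF j(1) y j(3)] unfolding P_def .
  obtain r where r: "y $ j * r = 1" "r * y $ j = 1"
    using dual_quat_right_left_inverse[OF j(3)] .
  have inv: "X * P * (Q * Y) = 1\<^sub>m n"
  proof -
    have "X * P * (Q * Y) = X * (P * Q * Y)"
      using X P Q(1) Y by (simp add: assoc_mult_mat[of _ n n _ n _ n])
    then show ?thesis using Y Q(2) XY by simp
  qed
  have "bij_betw (\<pi>(j := k)) (insert j J) {..<Suc k}"
  proof -
    have "bij_betw (\<pi>(j := k)) J {..<k}"
      using \<pi> j(2) by (subst bij_betw_cong[where g = \<pi>]) auto
    moreover have "bij_betw (\<pi>(j := k)) {j} {k}" by (simp add: bij_betw_def)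
    ultimately have "bij_betw (\<pi>(j := k)) (J \<union> {j}) ({..<k} \<union> {k})"
      by (rule bij_betw_combine) simp
    then show ?thesis by (simp add: lessThan_Suc)
  qed
  moreover have "\<forall>l\<in>insert j J. \<forall>i<n. (X * P) $$ (i, l) = xs ! (\<pi>(j := k)) l $ i"
    using j J cols by (auto simp: P_def mult_exchange_mat[OF X y] Xy x_def simp del: index_mult_mat)
  \<comment> \<open>The new factor \<open>y\<^sub>j\<^sup>* y\<^sub>j\<close> has the left inverse \<open>r r\<^sup>*\<close>.\<close>
  moreover have "N' * (r * dq_cnj r) * (dq_cnj (y $ j) * y $ j * N) = 1"
  proof -
    have "dq_cnj r * dq_cnj (y $ j) = 1" using r by (simp flip: dq_cnj_mult)
    then have "r * dq_cnj r * (dq_cnj (y $ j) * y $ j) = 1"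
      using r by (metis mult.assoc mult_1_left)
    then show ?thesis using N by (metis mult.assoc mult_1_left)
  qed
  moreover have "cycle_det (\<lambda>i l. (dq_adjoint (X * P) * A * (X * P)) $$ (i, l)) {..<n} =
      dq_cnj (y $ j) * y $ j * N * cycle_det (\<lambda>i l. A $$ (i, l)) {..<n}"
    if A: "A \<in> carrier_mat n n" "dq_hermitian A" for A
  proof -
    let ?B = "dq_adjoint X * A * X"
    note X' = dq_adjoint_carrier[OF X] and P' = dq_adjoint_carrier[OF P]
    note XA = mult_carrier_mat[OF X' A(1)]
    have B: "?B \<in> carrier_mat n n" "dq_hermitian ?B"
      by (rule mult_carrier_mat[OF XA X], rule dq_hermitian_congruence[OF A X])
    have "dq_adjoint (X * P) * A * (X * P) = dq_adjoint P * (dq_adjoint X * A * (X * P))"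
      unfolding dq_adjoint_mult[OF X P] assoc_mult_mat[OF P' X' A(1)]
      by (rule assoc_mult_mat[OF P' XA mult_carrier_mat[OF X P]])
    also have "\<dots> = dq_adjoint P * ?B * P"
      unfolding assoc_mult_mat[OF XA X P, symmetric] by (rule assoc_mult_mat[OF P' B(1) P, symmetric])
    finally show ?thesis
      using cycle_det_exchange[OF B y j(1), folded P_def] det[OF A] by (simp add: mult.assoc)
  qed
  moreover have "X * P \<in> carrier_mat n n" "Q * Y \<in> carrier_mat n n" "insert j J \<subseteq> {..<n}"
    using X P Q Y J j(1) by auto
  ultimately show ?case
    using inv
    by - (rule exI[of _ "X * P"], rule exI[of _ "Q * Y"], rule exI[of _ "insert j J"],
        rule exI[of _ "\<pi>(j := k)"], rule exI[of _ "dq_cnj (y $ j) * y $ j * N"],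
        rule exI[of _ "N' * (r * dq_cnj r)"], blast)
qed

text \<open>
  The exchange uses up one index per vector. This bound makes the maximum in
  \<open>eigenvalue_mult\<close> one over a finite set.
\<close>

lemma right_independent_length_le:
  fixes xs :: "dual_quat vec list"
  assumes "\<forall>x\<in>set xs. x \<in> carrier_vec n" "right_independent n (map (map_vec std) xs)"
  shows "length xs \<le> n"
proof -
  obtain J \<pi> where "J \<subseteq> {..<n}" "bij_betw \<pi> J {..<length xs}"
    using exists_congruence_with_columns[OF assms order.refl] by blast
  then show ?thesis
    by (metis bij_betw_same_card card_lessThan card_mono finite_lessThan)
qed

section \<open>Eigenvectors of Hermitian matrices\<close>

definition dq_inner :: "nat \<Rightarrow> dual_quat vec \<Rightarrow> dual_quat vec \<Rightarrow> dual_quat" where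
  "dq_inner n x y = (\<Sum>i<n. dq_cnj (x $ i) * y $ i)"

lemma cnj_dq_inner: "dq_cnj (dq_inner n x y) = dq_inner n y x"
  by (simp add: dq_inner_def dq_cnj_sum dq_cnj_mult)

lemma dq_inner_hermitian:
  assumes A: "A \<in> carrier_mat n n" "dq_hermitian A" and x: "x \<in> carrier_vec n" and y: "y \<in> carrier_vec n"
  shows "dq_inner n x (A *\<^sub>v y) = dq_inner n (A *\<^sub>v x) y"
proof -
  have herm: "dq_cnj (A $$ (i, j)) = A $$ (j, i)" if "i < n" "j < n" for i j
    using dq_hermitian_on[OF A] that by (auto simp: hermitian_on_def)
  have "dq_inner n x (A *\<^sub>v y) = (\<Sum>i<n. \<Sum>j<n. dq_cnj (x $ i) * A $$ (i, j) * y $ j)"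
    by (simp add: dq_inner_def index_mult_vec_sum[OF A(1) y] sum_distrib_left mult.assoc del: index_mult_mat_vec)
  also have "\<dots> = (\<Sum>j<n. \<Sum>i<n. dq_cnj (x $ i) * A $$ (i, j) * y $ j)"
    by (rule sum.swap)
  also have "\<dots> = dq_inner n (A *\<^sub>v x) y"
    by (simp add: dq_inner_def index_mult_vec_sum[OF A(1) x] sum_distrib_right dq_cnj_sum dq_cnj_mult herm
        del: index_mult_mat_vec)
  finally show ?thesis .
qed

lemma quat_norm_sum_eq_0:
  fixes n :: nat
  assumes "(\<Sum>i<n. quat_cnj (w i) * w i) = 0" "i < n"
  shows "w i = 0"
proof -
  have Re: "Re_q (sum f S) = (\<Sum>i\<in>S. Re_q (f i))" for f and S :: "nat set"
    by (induction S rule: infinite_finite_induct) auto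
  have "(\<Sum>i<n. Re_q (quat_cnj (w i) * w i)) = 0"
    using arg_cong[OF assms(1), of Re_q] by (simp only: Re zero_quat.simps)
  moreover have "\<forall>i\<in>{..<n}. 0 \<le> Re_q (quat_cnj (w i) * w i)"
    by (simp add: flip: power2_eq_square)
  ultimately have "Re_q (quat_cnj (w i) * w i) = 0"
    using assms(2) by (subst (asm) sum_nonneg_eq_0_iff) auto
  then show ?thesis
    by (auto simp: quat_eq_iff add_nonneg_eq_0_iff simp flip: power2_eq_square)
qed

lemma sum_lessThan_add:
  fixes f :: "nat \<Rightarrow> 'a::comm_monoid_add"
  shows "(\<Sum>j<a + b. f j) = (\<Sum>j<a. f j) + (\<Sum>j<b. f (a + j))"
  by (induction b) (simp_all add: add.assoc)

text \<open>
  If \<open>w\<close> and \<open>z\<close> are combinations of \<open>us\<close> and \<open>vs\<close> with \<open>w + z = 0\<close>, then \<open>w\<^sup>* w = - w\<^sup>* z = 0\<close>, so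
  \<open>w = 0\<close> and \<open>z = 0\<close>.
\<close>

lemma right_independent_append:
  assumes us: "right_independent n us" and vs: "right_independent n vs"
    and orth: "\<forall>u\<in>set us. \<forall>v\<in>set vs. (\<Sum>i<n. quat_cnj (u $ i) * v $ i) = 0"
  shows "right_independent n (us @ vs)"
  unfolding right_independent_def
proof (intro allI impI)
  fix c j
  assume sum: "\<forall>i<n. (\<Sum>j<length (us @ vs). (us @ vs) ! j $ i * c j) = 0" and j: "j < length (us @ vs)"
  define w where "w i = (\<Sum>j<length us. us ! j $ i * c j)" for i
  define z where "z i = (\<Sum>j<length vs. vs ! j $ i * c (length us + j))" for i
  have wz: "w i + z i = 0" if "i < n" for i
  proof -
    have "(\<Sum>j<length (us @ vs). (us @ vs) ! j $ i * c j) =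
      (\<Sum>j<length us. (us @ vs) ! j $ i * c j) + (\<Sum>j<length vs. (us @ vs) ! (length us + j) $ i * c (length us + j))"
      unfolding length_append by (rule sum_lessThan_add)
    then show ?thesis using sum that by (simp add: w_def z_def nth_append)
  qed
  have cnj_sum: "quat_cnj (sum f S) = (\<Sum>i\<in>S. quat_cnj (f i))" for f and S :: "nat set"
    by (induction S rule: infinite_finite_induct) (auto simp: quat_cnj_add quat_eq_iff)
  have "(\<Sum>i<n. quat_cnj (w i) * z i) = (\<Sum>i<n. \<Sum>a<length us. \<Sum>b<length vs.
      quat_cnj (c a) * (quat_cnj (us ! a $ i) * vs ! b $ i) * c (length us + b))"
    by (simp add: w_def z_def cnj_sum quat_cnj_mult sum_product mult.assoc)
  also have "\<dots> = (\<Sum>a<length us. \<Sum>b<length vs. \<Sum>i<n.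
      quat_cnj (c a) * (quat_cnj (us ! a $ i) * vs ! b $ i) * c (length us + b))"
    by (subst sum.swap) (intro sum.cong refl sum.swap)
  also have "\<dots> = (\<Sum>a<length us. \<Sum>b<length vs.
      quat_cnj (c a) * (\<Sum>i<n. quat_cnj (us ! a $ i) * vs ! b $ i) * c (length us + b))"
    by (simp add: sum_distrib_left sum_distrib_right)
  also have "\<dots> = 0" using orth by (simp add: nth_mem)
  finally have "(\<Sum>i<n. quat_cnj (w i) * z i) = 0" .
  moreover have "quat_cnj (w i) * w i = - (quat_cnj (w i) * z i)" if "i < n" for i
    using wz[OF that] by (simp add: eq_neg_iff_add_eq_0 flip: distrib_left)
  ultimately have "(\<Sum>i<n. quat_cnj (w i) * w i) = 0"
    by (simp add: sum_negf)
  then have w: "w i = 0" if "i < n" for i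
    using quat_norm_sum_eq_0 that by blast
  then have z: "z i = 0" if "i < n" for i using wz that by force
  show "c j = 0"
  proof (cases "j < length us")
    case True
    then show ?thesis using us w unfolding right_independent_def w_def by auto
  next
    case False
    have "\<forall>b<length vs. c (length us + b) = 0"
      using vs[unfolded right_independent_def, THEN spec, of "\<lambda>b. c (length us + b)"] z
      unfolding z_def by auto
    then show ?thesis using False j by (metis add_diff_inverse_nat length_append nat_add_left_cancel_less)
  qed
qed

lemma right_eigenvector_mult:
  assumes A: "A \<in> carrier_mat n n" and ev: "right_eigenvector A y \<mu>"
  shows "dq_inner n x (A *\<^sub>v y) = dq_inner n x y * \<mu>" "y \<in> carrier_vec n"
proof -
  show y: "y \<in> carrier_vec n" using assms by (auto simp: right_eigenvector_def)
  show "dq_inner n x (A *\<^sub>v y) = dq_inner n x y * \<mu>"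
    using ev y by (simp add: right_eigenvector_def dq_inner_def sum_distrib_right mult.assoc)
qed

text \<open>
  For an eigenvector \<open>x\<close> the dual number \<open>h = x\<^sup>* x\<close> is invertible, since the standard part of \<open>x\<close> is
  nonzero, and \<open>h \<mu> = x\<^sup>* A x\<close> is self-conjugate.
\<close>

lemma right_eigenvalue_real:
  assumes A: "A \<in> carrier_mat n n" "dq_hermitian A" and ev: "right_eigenvector A x \<mu>"
  shows "dq_cnj \<mu> = \<mu>"
proof -
  note x = right_eigenvector_mult(2)[OF A(1) ev]
  define h where "h = dq_inner n x x"
  have h: "dq_cnj h = h" by (simp add: h_def cnj_dq_inner)
  have "std h = (\<Sum>i<n. quat_cnj (std (x $ i)) * std (x $ i))"
    by (simp add: h_def dq_inner_def std_sum)
  moreover have "\<exists>i<n. std (x $ i) \<noteq> 0"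
  proof (rule ccontr)
    assume "\<not> ?thesis"
    then have "map_vec std x = 0\<^sub>v (dim_row A)" using x A by (intro eq_vecI) auto
    then show False using ev by (simp add: right_eigenvector_def)
  qed
  ultimately have "std h \<noteq> 0" using quat_norm_sum_eq_0[of "\<lambda>i. std (x $ i)" n] by metis
  then obtain r where r: "r * h = 1" using dual_quat_right_left_inverse by metis
  have "h * \<mu> = dq_inner n x (A *\<^sub>v x)"
    by (simp add: h_def right_eigenvector_mult(1)[OF A(1) ev])
  moreover have "dq_cnj (dq_inner n x (A *\<^sub>v x)) = dq_inner n x (A *\<^sub>v x)"
    by (simp add: cnj_dq_inner dq_inner_hermitian[OF A x x])
  ultimately have "h * \<mu> = dq_cnj \<mu> * h" by (metis dq_cnj_mult h)
  also have "\<dots> = h * dq_cnj \<mu>" by (rule dq_real_commute[OF h, symmetric])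
  finally show ?thesis using r by (metis mult.assoc mult_1_left)
qed

text \<open>
  With \<open>t = x\<^sup>* y\<close>, the usual computation gives \<open>t \<nu> = t \<mu>\<close>. If the eigenvalues differ
  only by an infinitesimal, \<open>t\<close> need not vanish, but it cannot be invertible, so its standard part
  is zero in every case.
\<close>

lemma right_eigenvectors_orthogonal:
  assumes A: "A \<in> carrier_mat n n" "dq_hermitian A"
    and x: "right_eigenvector A x \<mu>" and y: "right_eigenvector A y \<nu>" and "\<mu> \<noteq> \<nu>"
  shows "(\<Sum>i<n. quat_cnj (std (x $ i)) * std (y $ i)) = 0"
proof (rule ccontr)
  define t where "t = dq_inner n x y"
  assume "\<not> ?thesis"
  then have "std t \<noteq> 0" by (simp add: t_def dq_inner_def std_sum)
  then obtain r where r: "r * t = 1" using dual_quat_right_left_inverse by metis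
  have \<mu>: "dq_cnj \<mu> = \<mu>" by (rule right_eigenvalue_real[OF A x])
  have "t * \<nu> = dq_inner n (A *\<^sub>v x) y"
    using right_eigenvector_mult[OF A(1) x] right_eigenvector_mult[OF A(1) y]
    by (metis dq_inner_hermitian[OF A] t_def)
  also have "\<dots> = dq_cnj (dq_inner n y (A *\<^sub>v x))" by (simp add: cnj_dq_inner)
  also have "\<dots> = \<mu> * t"
    by (simp add: right_eigenvector_mult(1)[OF A(1) x] dq_cnj_mult \<mu> cnj_dq_inner t_def)
  also have "\<dots> = t * \<mu>" by (rule dq_real_commute[OF \<mu>])
  finally show False using r \<open>\<mu> \<noteq> \<nu>\<close> by (metis mult.assoc mult_1_left)
qed

section \<open>The determinant as the product of the eigenvalues\<close>

text \<open>
  Exchange turns the eigenvectors into the columns of \<open>X\<close>, in some order, so \<open>l\<close> lists the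
  eigenvalues in that order. The factor \<open>N\<close> is compared with the identity matrix, for which
  \<open>X\<^sup>* X\<close> has determinant \<open>N\<close>, and then cancelled.
\<close>

lemma cycle_det_eigenbasis:
  assumes A: "A \<in> carrier_mat n n" "dq_hermitian A"
    and ev: "\<forall>(x, \<mu>)\<in>set ps. right_eigenvector A x \<mu>" and len: "length ps = n"
    and indep: "right_independent n (map (map_vec std) (map fst ps))"
  shows "cycle_det (\<lambda>i j. A $$ (i, j)) {..<n} = prod_list (map snd ps)"
proof -
  let ?D = "\<lambda>M. cycle_det (\<lambda>i j. M $$ (i, j)) {..<n}"
  have carr: "\<forall>x\<in>set (map fst ps). x \<in> carrier_vec n"
  proof
    fix x assume "x \<in> set (map fst ps)"
    then obtain \<mu> where "(x, \<mu>) \<in> set ps" by auto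
    then have "right_eigenvector A x \<mu>" using ev by blast
    then show "x \<in> carrier_vec n" by (rule right_eigenvector_mult(2)[OF A(1)])
  qed
  have "n \<le> length (map fst ps)" using len by simp
  from exists_congruence_with_columns[OF carr indep this] obtain X Y J \<pi> N N' where X: "X \<in> carrier_mat n n"
    and "Y \<in> carrier_mat n n" "X * Y = 1\<^sub>m n" and J: "J \<subseteq> {..<n}" and \<pi>: "bij_betw \<pi> J {..<n}"
    and cols: "\<forall>j\<in>J. \<forall>i<n. X $$ (i, j) = map fst ps ! \<pi> j $ i" and N: "N' * N = (1 :: dual_quat)"
    and det: "\<And>A. A \<in> carrier_mat n n \<Longrightarrow> dq_hermitian A \<Longrightarrow> ?D (dq_adjoint X * A * X) = N * ?D A"
    by auto
  have "card J = card {..<n}" using \<pi> by (rule bij_betw_same_card)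
  then have "J = {..<n}" using J by (metis card_subset_eq finite_lessThan)
  note \<pi> = \<pi>[unfolded this] and cols = cols[unfolded this]
  have \<pi>n: "\<pi> j < n" if "j < n" for j using \<pi> that by (auto dest: bij_betwE)
  define l where "l j = snd (ps ! \<pi> j)" for j
  have evj: "right_eigenvector A (fst (ps ! \<pi> j)) (l j)" if "j < n" for j
  proof -
    have "ps ! \<pi> j \<in> set ps" using \<pi>n[OF that] len by simp
    then show ?thesis using ev by (auto simp: l_def case_prod_unfold)
  qed
  have real: "\<forall>j\<in>{..<n}. dq_cnj (l j) = l j"
    using right_eigenvalue_real[OF A evj] by simp
  have AX: "(A * X) $$ (i, j) = X $$ (i, j) * l j" if ij: "i < n" "j < n" for i j
  proof -
    let ?x = "fst (ps ! \<pi> j)"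
    have x: "?x \<in> carrier_vec n" by (rule right_eigenvector_mult(2)[OF A(1) evj[OF ij(2)]])
    have Xx: "X $$ (m, j) = ?x $ m" if "m < n" for m
      using cols that ij \<pi>n len by simp
    have "(A * X) $$ (i, j) = (A *\<^sub>v ?x) $ i"
      using index_mult_sum[OF A(1) X ij] index_mult_vec_sum[OF A(1) x ij(1)] Xx by simp
    also have "\<dots> = ?x $ i * l j"
      using evj[OF ij(2)] x ij(1) by (simp add: right_eigenvector_def del: index_mult_mat_vec)
    finally show ?thesis using Xx ij by simp
  qed
  have X': "dq_adjoint X \<in> carrier_mat n n" using X by simp
  have XAX: "(dq_adjoint X * A * X) $$ (i, j) = (dq_adjoint X * 1\<^sub>m n * X) $$ (i, j) * l j"
    if ij: "i < n" "j < n" for i j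
  proof -
    have "(dq_adjoint X * A * X) $$ (i, j) = (dq_adjoint X * (A * X)) $$ (i, j)"
      using X X' A by (subst assoc_mult_mat[of _ n n _ n _ n]) auto
    also have "\<dots> = (\<Sum>m<n. dq_adjoint X $$ (i, m) * X $$ (m, j)) * l j"
      using index_mult_sum[OF X' mult_carrier_mat[OF A(1) X] ij] ij
      by (simp add: AX sum_distrib_right mult.assoc del: index_mult_mat)
    also have "\<dots> = (dq_adjoint X * X) $$ (i, j) * l j"
      using index_mult_sum[OF X' X ij] by simp
    finally show ?thesis using X' by simp
  qed
  have "N * ?D A = ?D (dq_adjoint X * A * X)" by (simp add: det[OF A])
  also have "\<dots> = cycle_det (\<lambda>i j. (dq_adjoint X * 1\<^sub>m n * X) $$ (i, j) * l j) {..<n}"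
    by (rule cycle_det_cong) (use XAX in auto)
  also have "\<dots> = ?D (dq_adjoint X * 1\<^sub>m n * X) * prod_list (map l [0..<n])"
    by (rule cycle_det_scale_columns[OF real]) auto
  also have "?D (dq_adjoint X * 1\<^sub>m n * X) = N * ?D (1\<^sub>m n)"
    by (rule det) (auto simp: dq_hermitian_one)
  also have "?D (1\<^sub>m n) = cycle_det (\<lambda>i j. if i = j then 1 else 0) {..<n}"
    by (rule cycle_det_cong) auto
  also have "\<dots> = 1" by (simp add: cycle_det_identity)
  finally have "N * ?D A = N * prod_list (map l [0..<n])" by simp
  then have "N' * N * ?D A = N' * N * prod_list (map l [0..<n])" by (simp only: mult.assoc)
  then have "?D A = prod_list (map l [0..<n])" by (simp add: N)
  also have "\<dots> = prod_list (map snd ps)"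
  proof (rule prod_list_real_perm)
    have "mset (map l [0..<n]) = image_mset l (mset_set {..<n})"
      by (simp add: lessThan_atLeast0)
    also have "\<dots> = image_mset (\<lambda>m. snd (ps ! m)) (image_mset \<pi> (mset_set {..<n}))"
      by (simp add: l_def[abs_def] multiset.map_comp comp_def)
    also have "image_mset \<pi> (mset_set {..<n}) = mset_set {..<n}"
      using \<pi> by (simp add: image_mset_mset_set bij_betw_def)
    also have "image_mset (\<lambda>m. snd (ps ! m)) (mset_set {..<n}) = mset (map (\<lambda>m. snd (ps ! m)) [0..<n])"
      by (simp add: lessThan_atLeast0)
    also have "map (\<lambda>m. snd (ps ! m)) [0..<n] = map snd ps"
      using len by (intro nth_equalityI) auto
    finally show "mset (map l [0..<n]) = mset (map snd ps)" .
  qed (use real in auto)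
  finally show ?thesis .
qed

lemma eigenvalue_mult_attained:
  assumes A: "A \<in> carrier_mat n n"
  obtains xs where "length xs = eigenvalue_mult A \<mu>" "\<forall>x\<in>set xs. right_eigenvector A x \<mu>"
    "right_independent n (map (map_vec std) xs)"
proof -
  let ?L = "{length xs | xs. (\<forall>x\<in>set xs. right_eigenvector A x \<mu>) \<and>
    right_independent (dim_row A) (map (map_vec std) xs)}"
  have "?L \<subseteq> {..n}"
    using right_independent_length_le[of _ n] right_eigenvector_mult(2)[OF A] A by auto
  then have "finite ?L" by (rule finite_subset) simp
  moreover have "length ([] :: dual_quat vec list) \<in> ?L"
    by (rule CollectI, rule exI[of _ "[]"]) (auto simp: right_independent_def)
  then have "?L \<noteq> {}" by blast
  ultimately have "eigenvalue_mult A \<mu> \<in> ?L"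
    unfolding eigenvalue_mult_def by (rule Max_in)
  then show thesis using that A by auto
qed

text \<open>
  The eigenvectors are collected one eigenvalue at a time; each new block is orthogonal, in its
  standard parts, to everything collected before.
\<close>

lemma independent_eigenvectors:
  assumes A: "A \<in> carrier_mat n n" "dq_hermitian A" and "distinct \<mu>s"
  shows "\<exists>ps. (\<forall>(x, \<mu>)\<in>set ps. right_eigenvector A x \<mu> \<and> \<mu> \<in> set \<mu>s) \<and>
    right_independent n (map (map_vec std) (map fst ps)) \<and>
    (\<forall>\<mu>. count (mset (map snd ps)) \<mu> = (if \<mu> \<in> set \<mu>s then eigenvalue_mult A \<mu> else 0))"
  using assms(3)
proof (induction \<mu>s)
  case Nil
  show ?case by (intro exI[of _ "[]"]) (auto simp: right_independent_def)
next
  case (Cons \<nu> \<mu>s)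
  then obtain ps where ps: "\<forall>(x, \<mu>)\<in>set ps. right_eigenvector A x \<mu> \<and> \<mu> \<in> set \<mu>s"
    and ind: "right_independent n (map (map_vec std) (map fst ps))"
    and cnt: "\<forall>\<mu>. count (mset (map snd ps)) \<mu> = (if \<mu> \<in> set \<mu>s then eigenvalue_mult A \<mu> else 0)"
    by auto
  obtain xs where xs: "length xs = eigenvalue_mult A \<nu>" "\<forall>x\<in>set xs. right_eigenvector A x \<nu>"
    "right_independent n (map (map_vec std) xs)"
    using eigenvalue_mult_attained[OF A(1)] .
  define qs where "qs = map (\<lambda>x. (x, \<nu>)) xs"
  have qs: "map fst qs = xs" "map snd qs = replicate (eigenvalue_mult A \<nu>) \<nu>"
    by (auto simp: qs_def comp_def map_replicate_const xs(1))
  have orth: "(\<Sum>i<n. quat_cnj (map_vec std x $ i) * map_vec std y $ i) = 0"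
    if xy: "x \<in> set xs" "y \<in> set (map fst ps)" for x y
  proof -
    obtain \<mu> where y: "right_eigenvector A y \<mu>" "\<mu> \<in> set \<mu>s" using xy(2) ps by force
    have x: "right_eigenvector A x \<nu>" using xy xs by simp
    have "\<nu> \<noteq> \<mu>" using y Cons.prems by auto
    then have "(\<Sum>i<n. quat_cnj (std (x $ i)) * std (y $ i)) = 0"
      by (rule right_eigenvectors_orthogonal[OF A x y(1)])
    then show ?thesis
      using right_eigenvector_mult(2)[OF A(1) x] right_eigenvector_mult(2)[OF A(1) y(1)] by simp
  qed
  have "right_independent n (map (map_vec std) (map fst (qs @ ps)))"
    unfolding map_append qs(1) by (rule right_independent_append[OF xs(3) ind]) (use orth in auto)
  moreover have "\<forall>(x, \<mu>)\<in>set (qs @ ps). right_eigenvector A x \<mu> \<and> \<mu> \<in> set (\<nu> # \<mu>s)"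
    using xs(2) ps by (auto simp: qs_def)
  moreover have "\<forall>\<mu>. count (mset (map snd (qs @ ps))) \<mu> = (if \<mu> \<in> set (\<nu> # \<mu>s) then eigenvalue_mult A \<mu> else 0)"
    unfolding map_append qs(2) mset_append using cnt Cons.prems by auto
  ultimately show ?case by blast
qed

theorem cycle_det_eigenvalue_list:
  assumes A: "A \<in> carrier_mat n n" "dq_hermitian A" and ls: "eigenvalue_list A ls"
  shows "cycle_det (\<lambda>i j. A $$ (i, j)) {..<n} = prod_list ls"
proof -
  obtain ps where ps: "\<forall>(x, \<mu>)\<in>set ps. right_eigenvector A x \<mu> \<and> \<mu> \<in> set (remdups ls)"
    and ind: "right_independent n (map (map_vec std) (map fst ps))"
    and cnt: "\<forall>\<mu>. count (mset (map snd ps)) \<mu> = (if \<mu> \<in> set (remdups ls) then eigenvalue_mult A \<mu> else 0)"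
    using independent_eigenvectors[OF A distinct_remdups[of ls]] by blast
  have mset: "mset (map snd ps) = mset ls"
  proof (rule multiset_eqI)
    fix \<mu>
    show "count (mset (map snd ps)) \<mu> = count (mset ls) \<mu>"
      using cnt ls by (auto simp: eigenvalue_list_def count_mset count_list_0_iff)
  qed
  have "length ps = length ls" using mset_eq_length[OF mset] by simp
  then have len: "length ps = n" using ls A by (simp add: eigenvalue_list_def)
  have "cycle_det (\<lambda>i j. A $$ (i, j)) {..<n} = prod_list (map snd ps)"
    by (rule cycle_det_eigenbasis[OF A _ len ind]) (use ps in auto)
  also have "\<dots> = prod_list ls"
    using ps right_eigenvalue_real[OF A] by (intro prod_list_real_perm mset) auto
  finally show ?thesis .
qed

theorem theorem4p1:
  fixes A :: "dual_quat mat" and n :: nat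
  assumes "n \<ge> 1" and "A \<in> carrier_mat n n" and "dq_hermitian A"
  shows "Mdet A = Cdet A \<and>
         (\<forall>ls. eigenvalue_list A ls \<longrightarrow> Mdet A = prod_list ls)"
  using Mdet_eq_cycle_det[OF assms(2,3)] Cdet_eq_cycle_det[OF assms(2,3)]
    cycle_det_eigenvalue_list[OF assms(2,3)]
  by simp

end
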